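(* Let $F$ be a continuous distribution function on $[0,1]^n$. Let $\mathcal{E}\subseteq[0,1]^n$ be such that there exists $x_0\in\mathcal{E}$ with $F(x_0)=\tfrac12$, and suppose there exists $\delta\in(0,1/4)$ such that $$\inf_{x,y\in\mathcal{D}_\delta}F(x\wedge y)>\delta,\qquad \mathcal{D}_\delta:=\Big\{x\in\mathcal{E}:\tfrac12-\delta\le F(x)\le\tfrac12+\delta\Big\}.$$ Then for every $w\in\mathbb{R}$, as $u\to\infty$, $$\mathbb{P}\Big\{\sup_{x\in\mathcal{E}}|W(x)|>u\,\Big|\,W(\mathbf 1)=w\Big\}\sim\mathbb{P}\Big\{\sup_{x\in\mathcal{E}}W(x)>u\,\Big|\,W(\mathbf 1)=w\Big\}+\mathbb{P}\Big\{\sup_{x\in\mathcal{E}}W(x)>u\,\Big|\,W(\mathbf 1)=-w\Big\}.$$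
   Context: $x\wedge y$ is the componentwise minimum; $\mathbf 1=(1,\dots,1)$. $W$ is the Brownian sheet determined by $F$: the centered Gaussian random field on $[0,1]^n$ with covariance $\mathbb{E}[W(x)W(y)]=F(x\wedge y)$. Conditional probabilities given $W(\mathbf 1)=v$ are defined through the conditional field $W(x)-F(x)W(\mathbf 1)+F(x)v$, e.g. $\mathbb{P}\{\sup_{x\in\mathcal E}|W(x)|>u\mid W(\mathbf 1)=v\}=\mathbb{P}\{\sup_{x\in\mathcal E}|W(x)-F(x)W(\mathbf 1)+F(x)v|>u\}$. *)

theory Defs
  imports "HOL-Probability.Probability" "HOL-Library.Landau_Symbols"
begin

abbreviation unit_cube :: "(real^'n) set" where
  "unit_cube \<equiv> cbox 0 One"

definition meet :: "real^'n \<Rightarrow> real^'n \<Rightarrow> real^'n" where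
  "meet x y = (\<chi> i. min (x $ i) (y $ i))"

definition distribution_function_cube :: "(real^'n \<Rightarrow> real) \<Rightarrow> bool" where
  "distribution_function_cube F \<longleftrightarrow>
     (\<exists>\<mu>. sets \<mu> = sets borel \<and> prob_space \<mu> \<and> emeasure \<mu> (UNIV - unit_cube) = 0 \<and>
          (\<forall>x\<in>unit_cube. F x = measure \<mu> (cbox 0 x)))"

definition centered_gaussian_rv :: "'a measure \<Rightarrow> ('a \<Rightarrow> real) \<Rightarrow> real \<Rightarrow> bool" where
  "centered_gaussian_rv M X v \<longleftrightarrow>
     X \<in> borel_measurable M \<and>
     (if v = 0 then (AE \<omega> in M. X \<omega> = 0)
      else v > 0 \<and> distributed M lborel X (normal_density 0 (sqrt v)))"

text \<open>W is (a continuous version of) the Brownian sheet determined by F on the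
  probability space M: a centered Gaussian field on [0,1]^n with covariance
  E[W(x)W(y)] = F(x /\ y), i.e. every finite linear combination is centered
  Gaussian with the corresponding variance; sample paths are continuous.\<close>
definition brownian_sheet :: "'a measure \<Rightarrow> (real^'n \<Rightarrow> real) \<Rightarrow> (real^'n \<Rightarrow> 'a \<Rightarrow> real) \<Rightarrow> bool" where
  "brownian_sheet M F W \<longleftrightarrow>
     prob_space M \<and>
     (\<forall>x\<in>unit_cube. W x \<in> borel_measurable M) \<and>
     (\<forall>S c. finite S \<longrightarrow> S \<subseteq> unit_cube \<longrightarrow>
        centered_gaussian_rv M (\<lambda>\<omega>. \<Sum>x\<in>S. c x * W x \<omega>)
          (\<Sum>x\<in>S. \<Sum>y\<in>S. c x * c y * F (meet x y))) \<and>
     (\<forall>\<omega>\<in>space M. continuous_on unit_cube (\<lambda>x. W x \<omega>))"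

text \<open>P{ sup_{x in E} |W(x)| > u | W(1) = v }, via the conditional field
  W(x) - F(x) W(1) + F(x) v.\<close>
definition cond_sup_abs_prob ::
  "'a measure \<Rightarrow> (real^'n \<Rightarrow> real) \<Rightarrow> (real^'n \<Rightarrow> 'a \<Rightarrow> real) \<Rightarrow> (real^'n) set \<Rightarrow> real \<Rightarrow> real \<Rightarrow> real" where
  "cond_sup_abs_prob M F W E v u =
     measure M {\<omega> \<in> space M. (SUP x\<in>E. \<bar>W x \<omega> - F x * W One \<omega> + F x * v\<bar>) > u}"

definition cond_sup_prob ::
  "'a measure \<Rightarrow> (real^'n \<Rightarrow> real) \<Rightarrow> (real^'n \<Rightarrow> 'a \<Rightarrow> real) \<Rightarrow> (real^'n) set \<Rightarrow> real \<Rightarrow> real \<Rightarrow> real" where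
  "cond_sup_prob M F W E v u =
     measure M {\<omega> \<in> space M. (SUP x\<in>E. W x \<omega> - F x * W One \<omega> + F x * v) > u}"

end

theory Submission
  imports Defs
begin

text \<open>
  Write \<open>B x = W x - F x * W 1\<close>. The event that the supremum of \<open>|B + F w|\<close> exceeds \<open>u\<close> is the union
  of the events that \<open>B + F w\<close>, respectively \<open>- B - F w\<close>, exceeds \<open>u\<close> somewhere on \<open>E\<close>. As \<open>- B\<close> has
  the law of \<open>B\<close>, the two probabilities are the two terms on the right-hand side, and it remains to see
  that the intersection is negligible against \<open>P(B x0 > u)\<close>, which is of order \<open>exp (- 2 u^2)\<close> up to
  \<open>exp (O(u))\<close>. On the intersection either \<open>|B|\<close> exceeds \<open>u - |w|\<close> outside of \<open>D\<close>, where the variance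
  \<open>F (1 - F)\<close> is at most \<open>1/4 - \<delta>^2\<close>, or \<open>B x - B y\<close> exceeds \<open>2 (u - |w|)\<close> for some \<open>x, y\<close> in \<open>D\<close>,
  where the variance is bounded away from \<open>1\<close> by the hypothesis on \<open>F (meet x y)\<close>.

  Both suprema are controlled by a tail bound with any exponent worse than the one given by the maximal
  variance. It follows from Fernique's theorem applied to the increments over a fine finite net, since
  path continuity makes the oscillation between net points small in probability. Fernique's theorem in
  turn rests on the rotation invariance of two independent copies, and this and the symmetry of \<open>B\<close> on
  the Cramer-Wold principle: characteristic functions of linear combinations determine joint laws.
\<close>

section \<open>The Cramer-Wold principle\<close>

text \<open>Dividing both weights by their common mass turns them into probability densities, and
  Levy's uniqueness theorem identifies the laws of \<open>X\<close> and \<open>Y\<close> under the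
  tilted measures. If the mass is zero, both weights vanish almost everywhere.\<close>

lemma weighted_law_unique:
  fixes X g :: "'a \<Rightarrow> real" and Y h :: "'b \<Rightarrow> real"
  assumes M: "prob_space M" and N: "prob_space N"
    and [measurable]: "X \<in> borel_measurable M" "Y \<in> borel_measurable N"
      "g \<in> borel_measurable M" "h \<in> borel_measurable N"
    and g: "\<And>\<omega>. 0 \<le> g \<omega>" "\<And>\<omega>. g \<omega> \<le> K"
    and h: "\<And>\<omega>. 0 \<le> h \<omega>" "\<And>\<omega>. h \<omega> \<le> K"
    and eq: "\<And>s. (CLINT \<omega>|M. g \<omega> * iexp (s * X \<omega>)) = (CLINT \<omega>|N. h \<omega> * iexp (s * Y \<omega>))"
    and A[measurable]: "A \<in> sets borel"
  shows "(LINT \<omega>|M. g \<omega> * indicator A (X \<omega>)) = (LINT \<omega>|N. h \<omega> * indicator A (Y \<omega>))"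
proof -
  interpret M: prob_space M by fact
  interpret N: prob_space N by fact
  have ig: "integrable M g"
    by (rule M.integrable_const_bound[where B=K]) (use g in auto)
  have ih: "integrable N h"
    by (rule N.integrable_const_bound[where B=K]) (use h in auto)
  define m where "m = (LINT \<omega>|M. g \<omega>)"
  \<comment> \<open>At \<open>s = 0\<close> the hypothesis compares the total masses of the
    weights.\<close>
  have "(CLINT \<omega>|M. complex_of_real (g \<omega>)) = (CLINT \<omega>|N. complex_of_real (h \<omega>))"
    using eq[of 0] by simp
  then have m: "m = (LINT \<omega>|N. h \<omega>)"
    unfolding m_def integral_complex_of_real by simp
  have "m \<ge> 0" unfolding m_def using g by simp
  show ?thesis
  proof (cases "m = 0")
    case True
    then have "AE \<omega> in M. g \<omega> = 0" "AE \<omega> in N. h \<omega> = 0"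
      using integral_nonneg_eq_0_iff_AE[OF ig] integral_nonneg_eq_0_iff_AE[OF ih] g h m
      by (auto simp: m_def)
    then have "(LINT \<omega>|M. g \<omega> * indicator A (X \<omega>)) = 0"
      "(LINT \<omega>|N. h \<omega> * indicator A (Y \<omega>)) = 0"
      by (auto intro!: integral_eq_zero_AE)
    then show ?thesis by simp
  next
    case False
    with \<open>m \<ge> 0\<close> have mp: "m > 0" by simp
    \<comment> \<open>Characteristic function and probabilities of a tilted law, for an arbitrary
      base measure so that both sides are instances.\<close>
    have tilt: "real_distribution (distr (density P (\<lambda>\<omega>. ennreal (f \<omega> / m))) borel Z)
        \<and> char (distr (density P (\<lambda>\<omega>. ennreal (f \<omega> / m))) borel Z) s
            = (CLINT \<omega>|P. f \<omega> * iexp (s * Z \<omega>)) / m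
        \<and> measure (distr (density P (\<lambda>\<omega>. ennreal (f \<omega> / m))) borel Z) A
            = (LINT \<omega>|P. f \<omega> * indicator A (Z \<omega>)) / m"
      if P: "prob_space P" and [measurable]: "Z \<in> borel_measurable P" "f \<in> borel_measurable P"
        and f: "\<And>\<omega>. 0 \<le> f \<omega>" "integrable P f" "(LINT \<omega>|P. f \<omega>) = m"
      for P :: "'c measure" and f Z s
    proof -
      interpret P: prob_space P by fact
      let ?D = "density P (\<lambda>\<omega>. ennreal (f \<omega> / m))"
      have D: "prob_space ?D"
      proof
        have "emeasure ?D (space ?D) = (\<integral>\<^sup>+\<omega>. ennreal (f \<omega> / m) \<partial>P)"
          by (subst emeasure_density) (auto intro!: nn_integral_cong)
        also have "\<dots> = ennreal (LINT \<omega>|P. f \<omega> / m)"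
          using f mp by (intro nn_integral_eq_integral) auto
        finally show "emeasure ?D (space ?D) = 1" using f mp by simp
      qed
      interpret D: prob_space ?D by fact
      have "prob_space (distr ?D borel Z)" by (rule D.prob_space_distr) simp
      then have 1: "real_distribution (distr ?D borel Z)"
        unfolding real_distribution_def real_distribution_axioms_def by simp
      have "char (distr ?D borel Z) s = (CLINT \<omega>|?D. iexp (s * Z \<omega>))"
        unfolding char_def by (subst integral_distr) auto
      also have "\<dots> = (CLINT \<omega>|P. (f \<omega> / m) *\<^sub>R iexp (s * Z \<omega>))"
        using f mp by (subst integral_density) auto
      also have "\<dots> = (CLINT \<omega>|P. (f \<omega> * iexp (s * Z \<omega>)) / m)"
        by (simp add: scaleR_conv_of_real)
      finally have 2: "char (distr ?D borel Z) s = (CLINT \<omega>|P. f \<omega> * iexp (s * Z \<omega>)) / m"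
        by simp
      have "measure (distr ?D borel Z) A = (LINT x|distr ?D borel Z. indicator A x)"
        by simp
      also have "\<dots> = (LINT \<omega>|?D. indicator A (Z \<omega>))"
        by (subst integral_distr) auto
      also have "\<dots> = (LINT \<omega>|P. (f \<omega> / m) *\<^sub>R indicator A (Z \<omega>))"
        using f mp by (subst integral_density) auto
      finally have 3: "measure (distr ?D borel Z) A = (LINT \<omega>|P. f \<omega> * indicator A (Z \<omega>)) / m"
        by simp
      from 1 2 3 show ?thesis by blast
    qed
    note tM = tilt[OF M _ _ g(1) ig m_def[symmetric]]
    note tN = tilt[OF N _ _ h(1) ih m[symmetric]]
    have "distr (density M (\<lambda>\<omega>. ennreal (g \<omega> / m))) borel X
        = distr (density N (\<lambda>\<omega>. ennreal (h \<omega> / m))) borel Y"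
      using tM[of X] tN[of Y] eq by (intro Levy_uniqueness) auto
    then show ?thesis using tM[of X] tN[of Y] mp by auto
  qed
qed

text \<open>Coordinates are processed one at a time: the weights \<open>1 + cos (L + \<alpha>)\<close> are nonnegative, so
  one-dimensional uniqueness applies to them, and they recover the complex exponential.\<close>
lemma cramer_wold_weighted:
  fixes X :: "'i \<Rightarrow> 'a \<Rightarrow> real" and Y :: "'i \<Rightarrow> 'b \<Rightarrow> real"
  assumes M: "prob_space M" and N: "prob_space N" and I: "finite I"
    and mX[measurable]: "\<And>i. i \<in> I \<Longrightarrow> X i \<in> borel_measurable M"
    and mY[measurable]: "\<And>i. i \<in> I \<Longrightarrow> Y i \<in> borel_measurable N"
    and eq: "\<And>c. (CLINT \<omega>|M. iexp (\<Sum>i\<in>I. c i * X i \<omega>)) = (CLINT \<omega>|N. iexp (\<Sum>i\<in>I. c i * Y i \<omega>))"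
    and J: "J \<subseteq> I"
    and A[measurable]: "\<And>i. i \<in> I \<Longrightarrow> A i \<in> sets borel"
  shows "(CLINT \<omega>|M. of_real (\<Prod>i\<in>J. indicator (A i) (X i \<omega>)) * iexp (\<Sum>i\<in>I. c i * X i \<omega>))
       = (CLINT \<omega>|N. of_real (\<Prod>i\<in>J. indicator (A i) (Y i \<omega>)) * iexp (\<Sum>i\<in>I. c i * Y i \<omega>))"
proof -
  interpret M: prob_space M by fact
  interpret N: prob_space N by fact
  have "finite J" using J I finite_subset by blast
  then show ?thesis using J
  proof (induction J arbitrary: c rule: finite_induct)
    case empty
    then show ?case using eq by simp
  next
    case (insert j J)
    then have jI: "j \<in> I" and JI: "J \<subseteq> I" by auto
    define p where "p = (\<lambda>(Z :: 'i \<Rightarrow> real). \<Prod>i\<in>J. indicator (A i) (Z i) :: real)"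
    define L where "L = (\<lambda>c (Z :: 'i \<Rightarrow> real). \<Sum>i\<in>I. c i * Z i)"
    let ?X = "\<lambda>\<omega> i. X i \<omega>" and ?Y = "\<lambda>\<omega> i. Y i \<omega>"
    have pm[measurable]: "(\<lambda>\<omega>. p (?X \<omega>)) \<in> borel_measurable M" "(\<lambda>\<omega>. p (?Y \<omega>)) \<in> borel_measurable N"
      unfolding p_def using JI
      by (auto intro!: borel_measurable_prod measurable_compose[OF mX borel_measurable_indicator]
           measurable_compose[OF mY borel_measurable_indicator] A)
    have Lm[measurable]: "(\<lambda>\<omega>. L c (?X \<omega>)) \<in> borel_measurable M" "(\<lambda>\<omega>. L c (?Y \<omega>)) \<in> borel_measurable N" for c
      unfolding L_def by measurable
    have p01: "0 \<le> p Z" "p Z \<le> 1" for Z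
      unfolding p_def by (auto intro!: prod_nonneg prod_le_1 simp: indicator_def)
    have IH: "(CLINT \<omega>|M. of_real (p (?X \<omega>)) * iexp (L c (?X \<omega>)))
            = (CLINT \<omega>|N. of_real (p (?Y \<omega>)) * iexp (L c (?Y \<omega>)))" for c
      using insert.IH[OF JI] by (simp add: p_def L_def)
    have np: "norm (of_real (p Z) * iexp t) \<le> 1" for Z t
      using p01 by (simp add: norm_mult)
    have iM: "complex_integrable M (\<lambda>\<omega>. of_real (p (?X \<omega>)) * iexp (L c (?X \<omega>)))" for c
      by (rule M.integrable_const_bound[where B=1]) (use np in auto)
    have iN: "complex_integrable N (\<lambda>\<omega>. of_real (p (?Y \<omega>)) * iexp (L c (?Y \<omega>)))" for c
      by (rule N.integrable_const_bound[where B=1]) (use np in auto)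
    \<comment> \<open>Multiplying by \<open>iexp (s * Z j)\<close> only alters the coefficient at
      \<open>j\<close>, so the product stays among the exponentials covered by the induction
      hypothesis, which allows all coefficients.\<close>
    have Lsh: "L (\<lambda>i. b * c i + (if i = j then s else 0)) Z = b * L c Z + s * Z j" for b c s Z
    proof -
      have "L (\<lambda>i. b * c i + (if i = j then s else 0)) Z
          = (\<Sum>i\<in>I. b * (c i * Z i) + (if i = j then s * Z i else 0))"
        unfolding L_def by (intro sum.cong) (auto simp: algebra_simps)
      also have "\<dots> = b * L c Z + s * Z j"
        using jI I by (simp add: sum.distrib L_def sum_distrib_left)
      finally show ?thesis .
    qed
    \<comment> \<open>Euler's formula for the cosine: the three summands carry the coefficients
      \<open>c\<close> scaled by 0, 1 and -1.\<close>
    have pt: "complex_of_real (p Z * (1 + cos (L c Z + \<alpha>))) * iexp (s * Z j)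
      = of_real (p Z) * iexp (L (\<lambda>i. 0 * c i + (if i = j then s else 0)) Z)
       + (iexp \<alpha> / 2) * (of_real (p Z) * iexp (L (\<lambda>i. 1 * c i + (if i = j then s else 0)) Z))
       + (iexp (- \<alpha>) / 2) * (of_real (p Z) * iexp (L (\<lambda>i. - 1 * c i + (if i = j then s else 0)) Z))"
      for Z \<alpha> s c
      unfolding Lsh
      by (simp add: cos_exp_eq cos_of_real[symmetric] exp_add exp_diff exp_minus field_simps)
    have lin: "(LINT \<omega>|P. f \<omega> + a * g \<omega> + b * h \<omega>) = integral\<^sup>L P f + a * integral\<^sup>L P g + b * integral\<^sup>L P h"
      if "integrable P f" "integrable P g" "integrable P h"
      for P :: "'p measure" and f g h :: "'p \<Rightarrow> complex" and a b
      using that by simp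
    have shift: "(LINT \<omega>|M. p (?X \<omega>) * (1 + cos (L c (?X \<omega>) + \<alpha>)) * indicator (A j) (X j \<omega>))
        = (LINT \<omega>|N. p (?Y \<omega>) * (1 + cos (L c (?Y \<omega>) + \<alpha>)) * indicator (A j) (Y j \<omega>))" for c \<alpha>
    proof (rule weighted_law_unique[where K=2, OF M N])
      have "0 \<le> 1 + cos y" "1 + cos y \<le> 2" for y :: real
        using cos_ge_minus_one[of y] cos_le_one[of y] by linarith+
      then show "0 \<le> p (?X \<omega>) * (1 + cos (L c (?X \<omega>) + \<alpha>))" "p (?X \<omega>) * (1 + cos (L c (?X \<omega>) + \<alpha>)) \<le> 2" for \<omega>
        using p01[of "?X \<omega>"] mult_mono[OF p01(2)[of "?X \<omega>"], of "1 + cos (L c (?X \<omega>) + \<alpha>)" 2] by auto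
      have "0 \<le> 1 + cos y" "1 + cos y \<le> 2" for y :: real
        using cos_ge_minus_one[of y] cos_le_one[of y] by linarith+
      then show "0 \<le> p (?Y \<omega>) * (1 + cos (L c (?Y \<omega>) + \<alpha>))" "p (?Y \<omega>) * (1 + cos (L c (?Y \<omega>) + \<alpha>)) \<le> 2" for \<omega>
        using p01[of "?Y \<omega>"] mult_mono[OF p01(2)[of "?Y \<omega>"], of "1 + cos (L c (?Y \<omega>) + \<alpha>)" 2] by auto
      show "(CLINT \<omega>|M. complex_of_real (p (?X \<omega>) * (1 + cos (L c (?X \<omega>) + \<alpha>))) * iexp (s * X j \<omega>))
          = (CLINT \<omega>|N. complex_of_real (p (?Y \<omega>) * (1 + cos (L c (?Y \<omega>) + \<alpha>))) * iexp (s * Y j \<omega>))" for s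
        unfolding pt[of "?X _"] pt[of "?Y _"] lin[OF iM iM iM] lin[OF iN iN iN] IH ..
    qed (use jI in \<open>auto intro!: borel_measurable_times borel_measurable_add borel_measurable_cos\<close>)
    have ind: "(\<lambda>\<omega>. indicator (A j) (X j \<omega>) :: real) \<in> borel_measurable M"
      "(\<lambda>\<omega>. indicator (A j) (Y j \<omega>) :: real) \<in> borel_measurable N"
      using jI by (auto intro!: measurable_compose[OF mX borel_measurable_indicator]
           measurable_compose[OF mY borel_measurable_indicator] A)
    note [measurable] = ind
    define q where "q = (\<lambda>(Z :: 'i \<Rightarrow> real). p Z * indicator (A j) (Z j))"
    have qm[measurable]: "(\<lambda>\<omega>. q (?X \<omega>)) \<in> borel_measurable M" "(\<lambda>\<omega>. q (?Y \<omega>)) \<in> borel_measurable N"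
      unfolding q_def by measurable
    have nq: "norm (q Z) \<le> 1" "norm (q Z * cos t) \<le> 1" "norm (q Z * sin t) \<le> 1" for Z t
      using p01[of Z] by (auto simp: q_def abs_mult indicator_def mult_le_one)
    have iq: "integrable M (\<lambda>\<omega>. q (?X \<omega>))" "integrable M (\<lambda>\<omega>. q (?X \<omega>) * cos (L c (?X \<omega>) + \<alpha>))"
      "integrable N (\<lambda>\<omega>. q (?Y \<omega>))" "integrable N (\<lambda>\<omega>. q (?Y \<omega>) * cos (L c (?Y \<omega>) + \<alpha>))"
      "integrable M (\<lambda>\<omega>. q (?X \<omega>) * sin (L c (?X \<omega>)))" "integrable N (\<lambda>\<omega>. q (?Y \<omega>) * sin (L c (?Y \<omega>)))" for c \<alpha>
      by (rule M.integrable_const_bound[where B=1] N.integrable_const_bound[where B=1];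
          (use nq in auto)?)+
    have s1: "(LINT \<omega>|M. q (?X \<omega>)) + (LINT \<omega>|M. q (?X \<omega>) * cos (L c (?X \<omega>) + \<alpha>))
       = (LINT \<omega>|N. q (?Y \<omega>)) + (LINT \<omega>|N. q (?Y \<omega>) * cos (L c (?Y \<omega>) + \<alpha>))" for c \<alpha>
      using shift[of c \<alpha>] iq
      by (subst (1 2) Bochner_Integration.integral_add[symmetric]) (auto simp: q_def algebra_simps)
    \<comment> \<open>With zero coefficients and zero phase the cosine is 1, so \<open>s1\<close>
      equates twice the integrals of \<open>q\<close>. Cancelling these in \<open>s1\<close>
      isolates the cosine term.\<close>
    have "L (\<lambda>_. 0) Z = 0" for Z by (simp add: L_def)
    then have s2: "(LINT \<omega>|M. q (?X \<omega>)) = (LINT \<omega>|N. q (?Y \<omega>))"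
      using s1[of "\<lambda>_. 0" 0] by simp
    have s3: "(LINT \<omega>|M. q (?X \<omega>) * cos (L c (?X \<omega>) + \<alpha>)) = (LINT \<omega>|N. q (?Y \<omega>) * cos (L c (?Y \<omega>) + \<alpha>))" for \<alpha>
      using s1[of c \<alpha>] s2 by simp
    \<comment> \<open>The phases 0 and \<open>- (pi/2)\<close> yield the real and the imaginary part
      of the exponential.\<close>
    have s4: "(LINT \<omega>|M. q (?X \<omega>) * cos (L c (?X \<omega>))) = (LINT \<omega>|N. q (?Y \<omega>) * cos (L c (?Y \<omega>)))"
      using s3[of 0] by simp
    have s5: "(LINT \<omega>|M. q (?X \<omega>) * sin (L c (?X \<omega>))) = (LINT \<omega>|N. q (?Y \<omega>) * sin (L c (?Y \<omega>)))"
      using s3[of "- (pi/2)"] by (simp add: cos_diff)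
    have dec: "of_real (\<Prod>i\<in>insert j J. indicator (A i) (Z i)) * iexp (\<Sum>i\<in>I. c i * Z i)
      = complex_of_real (q Z * cos (L c Z)) + \<i> * complex_of_real (q Z * sin (L c Z))" for Z
    proof -
      have e1: "(\<Prod>i\<in>insert j J. indicator (A i) (Z i)) = q Z"
        using insert(1,2) by (simp add: q_def p_def mult.commute)
      have e2: "iexp t = complex_of_real (cos t) + \<i> * complex_of_real (sin t)" for t
        by (simp add: cis_conv_exp[symmetric] complex_eq_iff)
      show ?thesis unfolding e1 e2 L_def by (simp only: of_real_mult distrib_left mult_ac)
    qed
    have iq0: "integrable M (\<lambda>\<omega>. q (?X \<omega>) * cos (L c (?X \<omega>)))" "integrable N (\<lambda>\<omega>. q (?Y \<omega>) * cos (L c (?Y \<omega>)))"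
      using iq(2)[of c 0] iq(4)[of c 0] by auto
    show ?case
      unfolding dec[of "?X _"] dec[of "?Y _"] using iq0 iq s4 s5
      by (subst (1 2) Bochner_Integration.integral_add)
         (auto simp del: of_real_mult intro!: integrable_mult_right)
  qed
qed

text \<open>For finitely many coordinates this is \<open>cramer_wold_weighted\<close> with all
  coordinates restricted and zero coefficients. A countable family is exhausted by finite ones, and
  continuity from above gives the limit.\<close>

lemma law_eq_on_rectangles:
  fixes X :: "'i \<Rightarrow> 'a \<Rightarrow> real" and Y :: "'i \<Rightarrow> 'b \<Rightarrow> real"
  assumes M: "prob_space M" and N: "prob_space N" and I: "countable I"
    and mX: "\<And>i. i \<in> I \<Longrightarrow> X i \<in> borel_measurable M"
    and mY: "\<And>i. i \<in> I \<Longrightarrow> Y i \<in> borel_measurable N"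
    and eq: "\<And>K c. finite K \<Longrightarrow> K \<subseteq> I \<Longrightarrow>
      (CLINT \<omega>|M. iexp (\<Sum>i\<in>K. c i * X i \<omega>)) = (CLINT \<omega>|N. iexp (\<Sum>i\<in>K. c i * Y i \<omega>))"
    and A: "\<And>i. i \<in> I \<Longrightarrow> A i \<in> sets borel"
  shows "measure M {\<omega> \<in> space M. \<forall>i\<in>I. X i \<omega> \<in> A i} = measure N {\<omega> \<in> space N. \<forall>i\<in>I. Y i \<omega> \<in> A i}"
proof -
  interpret M: prob_space M by fact
  interpret N: prob_space N by fact
  have prod_ind: "complex_of_real (\<Prod>i\<in>K. indicator (A i) (Z i)) = of_real (indicator {z. \<forall>i\<in>K. z i \<in> A i} Z)"
    if "finite K" for K and Z :: "'i \<Rightarrow> real"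
    using that by (induction K rule: finite_induct) (auto simp: indicator_def)
  have sets1: "{\<omega> \<in> space M. \<forall>i\<in>K. X i \<omega> \<in> A i} \<in> sets M"
    "{\<omega> \<in> space N. \<forall>i\<in>K. Y i \<omega> \<in> A i} \<in> sets N" if "finite K" "K \<subseteq> I" for K
  proof -
    have "{\<omega> \<in> space M. X i \<omega> \<in> A i} \<in> sets M" "{\<omega> \<in> space N. Y i \<omega> \<in> A i} \<in> sets N" if "i \<in> I" for i
      using measurable_sets[OF mX A, OF that that] measurable_sets[OF mY A, OF that that]
      by (auto simp: vimage_def Int_def conj_commute)
    then show "{\<omega> \<in> space M. \<forall>i\<in>K. X i \<omega> \<in> A i} \<in> sets M" "{\<omega> \<in> space N. \<forall>i\<in>K. Y i \<omega> \<in> A i} \<in> sets N"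
      using that by (auto intro!: sets.sets_Collect_finite_All)
  qed
  have fin: "measure M {\<omega> \<in> space M. \<forall>i\<in>K. X i \<omega> \<in> A i} = measure N {\<omega> \<in> space N. \<forall>i\<in>K. Y i \<omega> \<in> A i}"
    if K: "finite K" "K \<subseteq> I" for K
  proof -
    have "(CLINT \<omega>|M. of_real (\<Prod>i\<in>K. indicator (A i) (X i \<omega>)) * iexp (\<Sum>i\<in>K. 0 * X i \<omega>))
       = (CLINT \<omega>|N. of_real (\<Prod>i\<in>K. indicator (A i) (Y i \<omega>)) * iexp (\<Sum>i\<in>K. 0 * Y i \<omega>))"
      by (rule cramer_wold_weighted[OF M N]) (use K mX mY A eq in auto)
    then have "(LINT \<omega>|M. indicator {z. \<forall>i\<in>K. z i \<in> A i} (\<lambda>i. X i \<omega>) :: real)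
       = (LINT \<omega>|N. indicator {z. \<forall>i\<in>K. z i \<in> A i} (\<lambda>i. Y i \<omega>))"
      unfolding prod_ind[OF K(1)] by (simp del: of_real_indicator)
    moreover have "(LINT \<omega>|M. indicator {z. \<forall>i\<in>K. z i \<in> A i} (\<lambda>i. X i \<omega>) :: real)
        = (LINT \<omega>|M. indicator {\<omega> \<in> space M. \<forall>i\<in>K. X i \<omega> \<in> A i} \<omega>)"
      by (intro Bochner_Integration.integral_cong) (auto simp: indicator_def)
    moreover have "(LINT \<omega>|N. indicator {z. \<forall>i\<in>K. z i \<in> A i} (\<lambda>i. Y i \<omega>) :: real)
        = (LINT \<omega>|N. indicator {\<omega> \<in> space N. \<forall>i\<in>K. Y i \<omega> \<in> A i} \<omega>)"
      by (intro Bochner_Integration.integral_cong) (auto simp: indicator_def)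
    ultimately show ?thesis using sets1[OF K] by simp
  qed
  show ?thesis
  proof (cases "I = {}")
    case True
    then show ?thesis by (simp add: M.prob_space N.prob_space)
  next
    case False
    define K where "K n = from_nat_into I ` {..n}" for n
    have K: "finite (K n)" "K n \<subseteq> I" for n
      unfolding K_def using from_nat_into[OF False] by auto
    have un: "(\<Union>n. K n) = I"
      unfolding K_def image_UN[symmetric] UN_atMost_UNIV by (rule range_from_nat_into[OF False I])
    have mono: "K n \<subseteq> K (Suc n)" for n by (auto simp: K_def)
    let ?S = "\<lambda>n. {\<omega> \<in> space M. \<forall>i\<in>K n. X i \<omega> \<in> A i}" and ?T = "\<lambda>n. {\<omega> \<in> space N. \<forall>i\<in>K n. Y i \<omega> \<in> A i}"
    have "(\<lambda>n. measure M (?S n)) \<longlonglongrightarrow> measure M (\<Inter>n. ?S n)"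
      by (rule M.finite_Lim_measure_decseq) (use sets1[OF K] subsetD[OF mono] in \<open>auto intro!: decseq_SucI\<close>)
    moreover have "(\<lambda>n. measure N (?T n)) \<longlonglongrightarrow> measure N (\<Inter>n. ?T n)"
      by (rule N.finite_Lim_measure_decseq) (use sets1[OF K] subsetD[OF mono] in \<open>auto intro!: decseq_SucI\<close>)
    moreover have "measure M (?S n) = measure N (?T n)" for n by (rule fin[OF K])
    ultimately have "measure M (\<Inter>n. ?S n) = measure N (\<Inter>n. ?T n)"
      using LIMSEQ_unique by auto
    moreover have "(\<Inter>n. ?S n) = {\<omega> \<in> space M. \<forall>i\<in>I. X i \<omega> \<in> A i}" "(\<Inter>n. ?T n) = {\<omega> \<in> space N. \<forall>i\<in>I. Y i \<omega> \<in> A i}"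
      unfolding un[symmetric] by auto
    ultimately show ?thesis by simp
  qed
qed

section \<open>Gaussian spaces and Fernique's theorem\<close>

lemma centered_gaussian_rv_second_moment:
  assumes "prob_space M" and X: "centered_gaussian_rv M X v"
  shows "integrable M (\<lambda>\<omega>. (X \<omega>)\<^sup>2)" and "(LINT \<omega>|M. (X \<omega>)\<^sup>2) = v" and "0 \<le> v"
proof -
  interpret prob_space M by fact
  have [measurable]: "X \<in> borel_measurable M" using X by (simp add: centered_gaussian_rv_def)
  have "integrable M (\<lambda>\<omega>. (X \<omega>)\<^sup>2) \<and> (LINT \<omega>|M. (X \<omega>)\<^sup>2) = v \<and> 0 \<le> v"
  proof (cases "v = 0")
    case True
    then have "AE \<omega> in M. X \<omega> = 0" using X by (simp add: centered_gaussian_rv_def)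
    then have *: "AE \<omega> in M. (X \<omega>)\<^sup>2 = 0" by auto
    then have "integrable M (\<lambda>\<omega>. (X \<omega>)\<^sup>2)"
      by (subst integrable_cong_AE[where g="\<lambda>_. 0"]) auto
    then show ?thesis using * True by (auto intro: integral_eq_zero_AE)
  next
    case False
    then have v: "0 < sqrt v" and D: "distributed M lborel X (normal_density 0 (sqrt v))"
      using X by (auto simp: centered_gaussian_rv_def)
    have "integrable M (\<lambda>\<omega>. (X \<omega>)\<^sup>2)"
      using integrable_normal_moment[OF v, of 0 2] distributed_integrable[OF D, of "\<lambda>x. x\<^sup>2"] by simp
    moreover have "(LINT \<omega>|M. (X \<omega>)\<^sup>2) = v"
      using normal_distributed_variance[OF v D] normal_distributed_expectation[OF v D] v by simp
    ultimately show ?thesis using v by auto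
  qed
  then show "integrable M (\<lambda>\<omega>. (X \<omega>)\<^sup>2)" "(LINT \<omega>|M. (X \<omega>)\<^sup>2) = v" "0 \<le> v" by auto
qed

lemma centered_gaussian_rv_char:
  assumes "prob_space M" and X: "centered_gaussian_rv M X v"
  shows "(CLINT \<omega>|M. iexp (X \<omega>)) = exp (- v / 2)"
proof -
  interpret prob_space M by fact
  have [measurable]: "X \<in> borel_measurable M" using X by (simp add: centered_gaussian_rv_def)
  show ?thesis
  proof (cases "v = 0")
    case True
    then have "AE \<omega> in M. X \<omega> = 0" using X by (simp add: centered_gaussian_rv_def)
    then have "(CLINT \<omega>|M. iexp (X \<omega>)) = (CLINT \<omega>|M. 1)"
      by (intro integral_cong_AE) auto
    then show ?thesis using True by (simp add: prob_space)
  next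
    case False
    define \<sigma> where "\<sigma> = sqrt v"
    have v: "0 < \<sigma>" and D: "distributed M lborel X (normal_density 0 \<sigma>)"
      using X False by (auto simp: centered_gaussian_rv_def \<sigma>_def)
    have D1: "distributed M lborel (\<lambda>\<omega>. (X \<omega> - 0) / \<sigma>) std_normal_density"
      using normal_standard_normal_convert[OF v, of X 0] D by simp
    have "exp (- v / 2) = char std_normal_distribution \<sigma>"
      using v by (simp add: char_std_normal_distribution \<sigma>_def)
    also have "\<dots> = (CLINT x|distr M lborel (\<lambda>\<omega>. (X \<omega> - 0) / \<sigma>). iexp (\<sigma> * x))"
      unfolding char_def distributed_distr_eq_density[OF D1] ..
    also have "\<dots> = (CLINT \<omega>|M. iexp (\<sigma> * ((X \<omega> - 0) / \<sigma>)))"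
      by (rule integral_distr) auto
    finally show ?thesis using v by simp
  qed
qed

text \<open>Where \<open>e * x\<close> exceeds \<open>u\<close>, for a sign \<open>e\<close>, the
  centered density is at most \<open>exp (- u^2 / (2 * v))\<close> times the density centered at
  \<open>e * u\<close>, which integrates to 1. Allowing any \<open>\<sigma>2\<close> above
  \<open>v\<close> gives one bound for a whole family of variances, including the degenerate
  one.\<close>

lemma centered_gaussian_rv_tail_le:
  assumes "prob_space M" and X: "centered_gaussian_rv M X v"
    and v: "v \<le> \<sigma>2" "0 < \<sigma>2" and u: "0 \<le> u"
  shows "measure M {\<omega> \<in> space M. u < \<bar>X \<omega>\<bar>} \<le> 2 * exp (- u\<^sup>2 / (2 * \<sigma>2))"
proof -
  interpret prob_space M by fact
  have [measurable]: "X \<in> borel_measurable M" using X by (simp add: centered_gaussian_rv_def)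
  show ?thesis
  proof (cases "v = 0")
    case True
    then have "AE \<omega> in M. X \<omega> = 0" using X by (simp add: centered_gaussian_rv_def)
    then have "AE \<omega> in M. \<not> u < \<bar>X \<omega>\<bar>" using u by auto
    then have "measure M {\<omega> \<in> space M. u < \<bar>X \<omega>\<bar>} = 0" by (subst prob_eq_0) auto
    then show ?thesis by simp
  next
    case False
    define \<sigma> where "\<sigma> = sqrt v"
    have vp: "0 < v" and s: "0 < \<sigma>" and D: "distributed M lborel X (normal_density 0 \<sigma>)"
      using X False by (auto simp: centered_gaussian_rv_def \<sigma>_def)
    have s2: "\<sigma>\<^sup>2 = v" using vp by (simp add: \<sigma>_def)
    have half: "measure M {\<omega> \<in> space M. u < e * X \<omega>} \<le> exp (- u\<^sup>2 / (2 * v))" if e: "e = 1 \<or> e = -1" for e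
    proof -
      have pt: "normal_density 0 \<sigma> x * indicator {x. u < e * x} x \<le> exp (- u\<^sup>2 / (2 * v)) * normal_density (e * u) \<sigma> x" for x
      proof (cases "u < e * x")
        case True
        \<comment> \<open>Since \<open>e^2 = 1\<close>, the difference
          \<open>x^2 - u^2 - (x - e * u)^2\<close> is twice this product.\<close>
        have "0 \<le> u * (e * x - u)" using True u by simp
        then have "u\<^sup>2 + (x - e * u)\<^sup>2 \<le> x\<^sup>2"
          using e by (auto simp: power2_eq_square algebra_simps)
        then have "- x\<^sup>2 / (2 * v) \<le> - u\<^sup>2 / (2 * v) + - (x - e * u)\<^sup>2 / (2 * v)"
          using vp by (simp add: field_simps)
        then have "exp (- x\<^sup>2 / (2 * v)) \<le> exp (- u\<^sup>2 / (2 * v)) * exp (- (x - e * u)\<^sup>2 / (2 * v))"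
          by (simp add: exp_add[symmetric])
        then show ?thesis
          using True vp unfolding normal_density_def s2
          by (simp add: mult.left_commute divide_right_mono)
      qed simp
      have "emeasure M {\<omega> \<in> space M. u < e * X \<omega>} = emeasure M (X -` {x. u < e * x} \<inter> space M)"
        by (intro arg_cong[where f="emeasure M"]) auto
      also have "\<dots> = (\<integral>\<^sup>+x. ennreal (normal_density 0 \<sigma> x) * indicator {x. u < e * x} x \<partial>lborel)"
        by (rule distributed_emeasure[OF D]) auto
      also have "\<dots> \<le> (\<integral>\<^sup>+x. ennreal (exp (- u\<^sup>2 / (2 * v)) * normal_density (e * u) \<sigma> x) \<partial>lborel)"
      proof (intro nn_integral_mono)
        fix x
        show "ennreal (normal_density 0 \<sigma> x) * indicator {x. u < e * x} x
          \<le> ennreal (exp (- u\<^sup>2 / (2 * v)) * normal_density (e * u) \<sigma> x)"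
          using pt[of x] by (auto simp: indicator_def intro!: ennreal_leI)
      qed
      also have "\<dots> = ennreal (LINT x|lborel. exp (- u\<^sup>2 / (2 * v)) * normal_density (e * u) \<sigma> x)"
        using s by (intro nn_integral_eq_integral) auto
      also have "\<dots> = ennreal (exp (- u\<^sup>2 / (2 * v)))" using s by simp
      finally show ?thesis by (simp add: emeasure_eq_measure)
    qed
    have "measure M {\<omega> \<in> space M. u < \<bar>X \<omega>\<bar>}
        \<le> measure M ({\<omega> \<in> space M. u < 1 * X \<omega>} \<union> {\<omega> \<in> space M. u < -1 * X \<omega>})"
      by (intro finite_measure_mono) auto
    also have "\<dots> \<le> 2 * exp (- u\<^sup>2 / (2 * v))"
      using half[of 1] half[of "-1"] measure_Un_le[of "{\<omega> \<in> space M. u < 1 * X \<omega>}" M "{\<omega> \<in> space M. u < -1 * X \<omega>}"]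
      by auto
    also have "u\<^sup>2 / (2 * \<sigma>2) \<le> u\<^sup>2 / (2 * v)" using v vp by (intro divide_left_mono) auto
    then have "2 * exp (- u\<^sup>2 / (2 * v)) \<le> 2 * exp (- u\<^sup>2 / (2 * \<sigma>2))" by simp
    finally show ?thesis .
  qed
qed

text \<open>On the interval from \<open>u\<close> to \<open>u + 1\<close>, of length one, the
  density is at least its value at \<open>u + 1\<close>.\<close>

lemma centered_gaussian_rv_tail_ge:
  assumes "prob_space M" and X: "centered_gaussian_rv M X v" and v: "0 < v" and u: "0 \<le> u"
  shows "exp (- (u + 1)\<^sup>2 / (2 * v)) / sqrt (2 * pi * v) \<le> measure M {\<omega> \<in> space M. u < X \<omega>}"
proof -
  interpret prob_space M by fact
  have [measurable]: "X \<in> borel_measurable M" using X by (simp add: centered_gaussian_rv_def)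
  have D: "distributed M lborel X (normal_density 0 (sqrt v))"
    using X v by (auto simp: centered_gaussian_rv_def)
  let ?c = "exp (- (u + 1)\<^sup>2 / (2 * v)) / sqrt (2 * pi * v)"
  have "ennreal ?c = (\<integral>\<^sup>+x. ennreal ?c * indicator {u<..u+1} x \<partial>lborel)"
    by (simp add: nn_integral_cmult)
  also have "\<dots> \<le> (\<integral>\<^sup>+x. ennreal (normal_density 0 (sqrt v) x) * indicator {u<..} x \<partial>lborel)"
  proof (intro nn_integral_mono)
    fix x
    show "ennreal ?c * indicator {u<..u+1} x \<le> ennreal (normal_density 0 (sqrt v) x) * indicator {u<..} x"
    proof (cases "x \<in> {u<..u+1}")
      case True
      then have "x\<^sup>2 \<le> (u + 1)\<^sup>2" using u by (intro power_mono) auto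
      then have "exp (- (u + 1)\<^sup>2 / (2 * v)) \<le> exp (- x\<^sup>2 / (2 * v))"
        using v by (auto intro!: divide_right_mono)
      then have "?c \<le> normal_density 0 (sqrt v) x"
        using v by (simp add: normal_density_def divide_right_mono)
      then show ?thesis using True by (auto intro!: ennreal_leI)
    qed simp
  qed
  also have "\<dots> = emeasure M (X -` {u<..} \<inter> space M)"
    by (rule distributed_emeasure[OF D, symmetric]) auto
  also have "X -` {u<..} \<inter> space M = {\<omega> \<in> space M. u < X \<omega>}" by auto
  finally show ?thesis by (simp add: emeasure_eq_measure)
qed

text \<open>Closure under linear combinations makes every family in \<open>H\<close> jointly
  Gaussian, with a law determined by second moments.\<close>

locale gaussian_space = prob_space M for M :: "'a measure" +
  fixes H :: "('a \<Rightarrow> real) set"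
  assumes zero: "(\<lambda>_. 0) \<in> H"
    and comb: "X \<in> H \<Longrightarrow> Y \<in> H \<Longrightarrow> (\<lambda>\<omega>. a * X \<omega> + b * Y \<omega>) \<in> H"
    and gaussian: "X \<in> H \<Longrightarrow> \<exists>v. centered_gaussian_rv M X v"
begin

lemma sum: "finite K \<Longrightarrow> (\<And>i. i \<in> K \<Longrightarrow> X i \<in> H) \<Longrightarrow> (\<lambda>\<omega>. \<Sum>i\<in>K. c i * X i \<omega>) \<in> H"
proof (induction K rule: finite_induct)
  case empty
  then show ?case using zero by simp
next
  case (insert j K)
  then show ?case using comb[of "X j" "\<lambda>\<omega>. \<Sum>i\<in>K. c i * X i \<omega>" "c j" 1] by simp
qed

lemma rv:
  assumes "X \<in> H"
  shows "centered_gaussian_rv M X (expectation (\<lambda>\<omega>. (X \<omega>)\<^sup>2))"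
    and "integrable M (\<lambda>\<omega>. (X \<omega>)\<^sup>2)"
    and "X \<in> borel_measurable M"
    and "(CLINT \<omega>|M. iexp (X \<omega>)) = exp (- expectation (\<lambda>\<omega>. (X \<omega>)\<^sup>2) / 2)"
proof -
  obtain v where v: "centered_gaussian_rv M X v" using gaussian[OF assms] by auto
  note m = centered_gaussian_rv_second_moment[OF prob_space_axioms v]
  show "centered_gaussian_rv M X (expectation (\<lambda>\<omega>. (X \<omega>)\<^sup>2))" "integrable M (\<lambda>\<omega>. (X \<omega>)\<^sup>2)"
    using m v by auto
  show "X \<in> borel_measurable M" using v by (simp add: centered_gaussian_rv_def)
  show "(CLINT \<omega>|M. iexp (X \<omega>)) = exp (- expectation (\<lambda>\<omega>. (X \<omega>)\<^sup>2) / 2)"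
    using centered_gaussian_rv_char[OF prob_space_axioms v] m by simp
qed

text \<open>Changing all signs preserves the second moment of every linear combination, hence its
  characteristic function.\<close>

lemma symmetric_law:
  assumes I: "countable I" and X: "\<And>i. i \<in> I \<Longrightarrow> X i \<in> H" and A: "\<And>i. i \<in> I \<Longrightarrow> A i \<in> sets borel"
  shows "prob {\<omega> \<in> space M. \<forall>i\<in>I. X i \<omega> \<in> A i} = prob {\<omega> \<in> space M. \<forall>i\<in>I. - X i \<omega> \<in> A i}"
proof (rule law_eq_on_rectangles[OF prob_space_axioms prob_space_axioms I])
  fix K and c :: "'b \<Rightarrow> real" assume K: "finite K" "K \<subseteq> I"
  have 1: "(\<lambda>\<omega>. \<Sum>i\<in>K. c i * X i \<omega>) \<in> H" "(\<lambda>\<omega>. \<Sum>i\<in>K. (- c i) * X i \<omega>) \<in> H"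
    by (rule sum; use K X in blast)+
  have "expectation (\<lambda>\<omega>. (\<Sum>i\<in>K. (- c i) * X i \<omega>)\<^sup>2) = expectation (\<lambda>\<omega>. (\<Sum>i\<in>K. c i * X i \<omega>)\<^sup>2)"
    by (simp add: sum_negf)
  then show "(CLINT \<omega>|M. iexp (\<Sum>i\<in>K. c i * X i \<omega>)) = (CLINT \<omega>|M. iexp (\<Sum>i\<in>K. c i * - X i \<omega>))"
    using rv(4)[OF 1(1)] rv(4)[OF 1(2)] by simp
qed (use X A rv(3) in auto)

text \<open>The two coordinates of the product space are independent copies, so Fubini factors the
  characteristic function.\<close>

lemma pair_char:
  assumes X: "X \<in> H" and Y: "Y \<in> H"
  shows "(CLINT p|M \<Otimes>\<^sub>M M. iexp (X (fst p) + Y (snd p)))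
    = exp (- (expectation (\<lambda>\<omega>. (X \<omega>)\<^sup>2) + expectation (\<lambda>\<omega>. (Y \<omega>)\<^sup>2)) / 2)"
proof -
  interpret P: pair_prob_space M M ..
  note [measurable] = rv(3)[OF X] rv(3)[OF Y]
  have "(CLINT p|M \<Otimes>\<^sub>M M. iexp (X (fst p) + Y (snd p))) = (CLINT p|M \<Otimes>\<^sub>M M. iexp (X (fst p)) * iexp (Y (snd p)))"
    by (simp add: exp_add distrib_left)
  also have "\<dots> = (CLINT \<omega>|M. CLINT \<omega>'|M. iexp (X \<omega>) * iexp (Y \<omega>'))"
    by (subst P.integral_fst'[symmetric]) (auto intro!: P.P.integrable_const_bound[where B=1] simp: norm_mult)
  also have "\<dots> = (CLINT \<omega>|M. iexp (X \<omega>)) * (CLINT \<omega>'|M. iexp (Y \<omega>'))"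
    by simp
  also have "\<dots> = exp (- (expectation (\<lambda>\<omega>. (X \<omega>)\<^sup>2) + expectation (\<lambda>\<omega>. (Y \<omega>)\<^sup>2)) / 2)"
    unfolding rv(4)[OF X] rv(4)[OF Y] by (simp add: exp_add[symmetric] of_real_mult[symmetric] del: of_real_mult of_real_exp)
  finally show ?thesis .
qed

text \<open>The map from \<open>(x, y)\<close> to
  \<open>((x + y) / sqrt 2, (x - y) / sqrt 2)\<close> is orthogonal. It therefore preserves the
  variance of every linear combination of two independent copies, and with it their joint
  law.\<close>

lemma rotation_invariance:
  fixes X :: "'i \<Rightarrow> 'a \<Rightarrow> real"
  assumes I: "countable I" and X: "\<And>i. i \<in> I \<Longrightarrow> X i \<in> H"
    and A: "\<And>i. i \<in> I \<Longrightarrow> A i \<in> sets borel" and B: "\<And>i. i \<in> I \<Longrightarrow> B i \<in> sets borel"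
  shows "measure (M \<Otimes>\<^sub>M M) {p \<in> space (M \<Otimes>\<^sub>M M). \<forall>i\<in>I. X i (fst p) \<in> A i \<and> X i (snd p) \<in> B i}
    = measure (M \<Otimes>\<^sub>M M) {p \<in> space (M \<Otimes>\<^sub>M M). \<forall>i\<in>I.
        (X i (fst p) + X i (snd p)) / sqrt 2 \<in> A i \<and> (X i (fst p) - X i (snd p)) / sqrt 2 \<in> B i}"
proof -
  interpret P: pair_prob_space M M ..
  note mX[measurable] = rv(3)[OF X]
  \<comment> \<open>Indexing both copies by a sum type makes the joint law of the pair the law of a
    single family.\<close>
  define b :: "'i + 'i \<Rightarrow> 'i" where "b k = (case k of Inl i \<Rightarrow> i | Inr i \<Rightarrow> i)" for k
  define Z where "Z k p = (case k of Inl i \<Rightarrow> X i (fst p) | Inr i \<Rightarrow> X i (snd p))" for k and p :: "'a \<times> 'a"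
  define R where "R k p = (case k of Inl i \<Rightarrow> (X i (fst p) + X i (snd p)) / sqrt 2
      | Inr i \<Rightarrow> (X i (fst p) - X i (snd p)) / sqrt 2)" for k and p :: "'a \<times> 'a"
  define C where "C k = (case k of Inl i \<Rightarrow> A i | Inr i \<Rightarrow> B i)" for k
  have main: "measure (M \<Otimes>\<^sub>M M) {p \<in> space (M \<Otimes>\<^sub>M M). \<forall>k\<in>I <+> I. Z k p \<in> C k}
      = measure (M \<Otimes>\<^sub>M M) {p \<in> space (M \<Otimes>\<^sub>M M). \<forall>k\<in>I <+> I. R k p \<in> C k}"
  proof (rule law_eq_on_rectangles[OF P.prob_space_axioms P.prob_space_axioms])
    show "countable (I <+> I)" using I by simp
    show "Z k \<in> borel_measurable (M \<Otimes>\<^sub>M M)" "R k \<in> borel_measurable (M \<Otimes>\<^sub>M M)" "C k \<in> sets borel"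
      if "k \<in> I <+> I" for k
      using that A B by (auto simp: Z_def[abs_def] R_def[abs_def] C_def split: sum.splits)
    fix K and c :: "'i + 'i \<Rightarrow> real" assume K: "finite K" "K \<subseteq> I <+> I"
    \<comment> \<open>\<open>U\<close> collects the coefficients of the first copy and
      \<open>V\<close> those of the second; rotating replaces them by
      \<open>(U + V) / sqrt 2\<close> and \<open>(U - V) / sqrt 2\<close>.\<close>
    define U where "U = (\<lambda>\<omega>. \<Sum>k\<in>K. (case k of Inl i \<Rightarrow> c k | Inr i \<Rightarrow> 0) * X (b k) \<omega>)"
    define V where "V = (\<lambda>\<omega>. \<Sum>k\<in>K. (case k of Inl i \<Rightarrow> 0 | Inr i \<Rightarrow> c k) * X (b k) \<omega>)"
    have UV: "U \<in> H" "V \<in> H"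
      unfolding U_def V_def using K X by (auto intro!: sum simp: b_def split: sum.splits)
    have Z: "(\<Sum>k\<in>K. c k * Z k p) = U (fst p) + V (snd p)" for p
      unfolding U_def V_def sum.distrib[symmetric]
      by (intro sum.cong) (auto simp: Z_def b_def split: sum.splits)
    have R: "(\<Sum>k\<in>K. c k * R k p)
        = ((1 / sqrt 2) * U (fst p) + (1 / sqrt 2) * V (fst p)) + ((1 / sqrt 2) * U (snd p) + (- 1 / sqrt 2) * V (snd p))" for p
      unfolding U_def V_def sum.distrib[symmetric] sum_distrib_left
      by (intro sum.cong) (auto simp: R_def b_def diff_divide_distrib add_divide_distrib algebra_simps split: sum.splits)
    have S: "(\<lambda>\<omega>. (1 / sqrt 2) * U \<omega> + (1 / sqrt 2) * V \<omega>) \<in> H"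
      and D: "(\<lambda>\<omega>. (1 / sqrt 2) * U \<omega> + (- 1 / sqrt 2) * V \<omega>) \<in> H"
      by (rule comb[OF UV])+
    \<comment> \<open>The parallelogram law: the total variance is unchanged by the
      rotation.\<close>
    have "expectation (\<lambda>\<omega>. ((1 / sqrt 2) * U \<omega> + (1 / sqrt 2) * V \<omega>)\<^sup>2) + expectation (\<lambda>\<omega>. ((1 / sqrt 2) * U \<omega> + (- 1 / sqrt 2) * V \<omega>)\<^sup>2)
        = expectation (\<lambda>\<omega>. ((1 / sqrt 2) * U \<omega> + (1 / sqrt 2) * V \<omega>)\<^sup>2 + ((1 / sqrt 2) * U \<omega> + (- 1 / sqrt 2) * V \<omega>)\<^sup>2)"
      using rv(2)[OF S] rv(2)[OF D] by simp
    also have "\<dots> = expectation (\<lambda>\<omega>. (U \<omega>)\<^sup>2 + (V \<omega>)\<^sup>2)"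
      by (intro Bochner_Integration.integral_cong) (auto simp: power2_eq_square field_simps)
    also have "\<dots> = expectation (\<lambda>\<omega>. (U \<omega>)\<^sup>2) + expectation (\<lambda>\<omega>. (V \<omega>)\<^sup>2)"
      using rv(2)[OF UV(1)] rv(2)[OF UV(2)] by simp
    finally show "(CLINT p|M \<Otimes>\<^sub>M M. iexp (\<Sum>k\<in>K. c k * Z k p)) = (CLINT p|M \<Otimes>\<^sub>M M. iexp (\<Sum>k\<in>K. c k * R k p))"
      unfolding Z R pair_char[OF UV] pair_char[OF S D] by presburger
  qed
  have "(\<forall>k\<in>I <+> I. Q k) \<longleftrightarrow> (\<forall>i\<in>I. Q (Inl i) \<and> Q (Inr i))" for Q
    by auto
  note Plus = this
  have x1: "{p \<in> space (M \<Otimes>\<^sub>M M). \<forall>k\<in>I <+> I. Z k p \<in> C k}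
      = {p \<in> space (M \<Otimes>\<^sub>M M). \<forall>i\<in>I. X i (fst p) \<in> A i \<and> X i (snd p) \<in> B i}"
    by (simp add: Z_def C_def Plus)
  have x2: "{p \<in> space (M \<Otimes>\<^sub>M M). \<forall>k\<in>I <+> I. R k p \<in> C k}
      = {p \<in> space (M \<Otimes>\<^sub>M M). \<forall>i\<in>I. (X i (fst p) + X i (snd p)) / sqrt 2 \<in> A i \<and> (X i (fst p) - X i (snd p)) / sqrt 2 \<in> B i}"
    by (simp add: R_def C_def Plus)
  from main show ?thesis unfolding x1 x2 .
qed

lemma measure_pair_Times:
  assumes "S \<in> sets M" "T \<in> sets M"
  shows "measure (M \<Otimes>\<^sub>M M) (S \<times> T) = prob S * prob T"
proof -
  interpret P: pair_prob_space M M ..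
  show ?thesis using assms
    by (simp add: measure_def emeasure_pair_measure_Times enn2real_mult)
qed

text \<open>By rotation invariance the left-hand side is the probability that all normalized sums
  stay within \<open>s\<close> while some normalized difference exceeds \<open>t\<close>. Then both
  independent copies exceed \<open>(t - s) / sqrt 2\<close> at the same index, which accounts for
  the square.\<close>

lemma fernique_step:
  fixes X :: "'i \<Rightarrow> 'a \<Rightarrow> real"
  assumes I: "countable I" and X: "\<And>i. i \<in> I \<Longrightarrow> X i \<in> H"
  shows "(1 - prob {\<omega> \<in> space M. \<exists>i\<in>I. s < \<bar>X i \<omega>\<bar>}) * prob {\<omega> \<in> space M. \<exists>i\<in>I. t < \<bar>X i \<omega>\<bar>}
    \<le> (prob {\<omega> \<in> space M. \<exists>i\<in>I. (t - s) / sqrt 2 < \<bar>X i \<omega>\<bar>})\<^sup>2"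
proof -
  interpret P: pair_prob_space M M ..
  let ?P = "M \<Otimes>\<^sub>M M"
  define G where "G t = {\<omega> \<in> space M. \<forall>i\<in>I. X i \<omega> \<in> {-t..t}}" for t
  have mX[measurable]: "i \<in> I \<Longrightarrow> X i \<in> borel_measurable M" for i using rv(3) X by blast
  have G[measurable]: "G t \<in> sets M" for t
    unfolding G_def using I mX by (auto intro!: sets.sets_Collect_countable_All' )
  have E: "{\<omega> \<in> space M. \<exists>i\<in>I. t < \<bar>X i \<omega>\<bar>} = space M - G t" for t
    by (auto simp: G_def abs_le_iff not_le) (metis abs_le_iff minus_le_iff not_le)+
  \<comment> \<open>Sums confined to level \<open>s\<close>, differences to a set; the choice
    \<open>UNIV\<close> leaves the differences free.\<close>
  define R where "R s t = {p \<in> space ?P. \<forall>i\<in>I. (X i (fst p) + X i (snd p)) / sqrt 2 \<in> {-s..s}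
      \<and> (X i (fst p) - X i (snd p)) / sqrt 2 \<in> t}" for s and t :: "real set"
  have rot: "measure ?P (R s T) = measure ?P {p \<in> space ?P. \<forall>i\<in>I. X i (fst p) \<in> {-s..s} \<and> X i (snd p) \<in> T}"
    if "T \<in> sets borel" for T
    unfolding R_def by (rule rotation_invariance[OF I, symmetric]) (use X that in auto)
  have 1: "measure ?P (R s UNIV) = prob (G s)"
  proof -
    have "{p \<in> space ?P. \<forall>i\<in>I. X i (fst p) \<in> {-s..s} \<and> X i (snd p) \<in> UNIV} = G s \<times> space M"
      by (auto simp: G_def space_pair_measure)
    then show ?thesis using rot[of UNIV] measure_pair_Times[of "G s" "space M"] by (simp add: prob_space)
  qed
  have 2: "measure ?P (R s {-t..t}) = prob (G s) * prob (G t)"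
  proof -
    have "{p \<in> space ?P. \<forall>i\<in>I. X i (fst p) \<in> {-s..s} \<and> X i (snd p) \<in> {-t..t}} = G s \<times> G t"
      by (auto simp: G_def space_pair_measure)
    then show ?thesis using rot[of "{-t..t}"] measure_pair_Times[of "G s" "G t"] by simp
  qed
  have Rm[measurable]: "R s T \<in> sets ?P" if "T \<in> sets borel" for T
  proof -
    have "{p \<in> space ?P. (X i (fst p) + X i (snd p)) / sqrt 2 \<in> {-s..s} \<and> (X i (fst p) - X i (snd p)) / sqrt 2 \<in> T} \<in> sets ?P"
      if i: "i \<in> I" for i
    proof -
      note [measurable] = mX[OF i]
      let ?f = "\<lambda>p. (X i (fst p) + X i (snd p)) / sqrt 2" and ?g = "\<lambda>p. (X i (fst p) - X i (snd p)) / sqrt 2"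
      have f: "?f \<in> borel_measurable ?P" and g: "?g \<in> borel_measurable ?P" by measurable
      have "{p \<in> space ?P. ?f p \<in> {-s..s} \<and> ?g p \<in> T} = (?f -` {-s..s} \<inter> space ?P) \<inter> (?g -` T \<inter> space ?P)"
        by blast
      also have "\<dots> \<in> sets ?P"
        using f g \<open>T \<in> sets borel\<close> by (intro sets.Int measurable_sets[of _ _ borel]) simp_all
      finally show ?thesis .
    qed
    then show ?thesis unfolding R_def by (rule sets.sets_Collect_countable_All'[OF _ I])
  qed
  have "prob (G s) * (1 - prob (G t)) = measure ?P (R s UNIV) - measure ?P (R s {-t..t})"
    unfolding 1 2 by (simp add: algebra_simps)
  also have "\<dots> = measure ?P (R s UNIV - R s {-t..t})"
  proof (rule P.P.finite_measure_Diff[symmetric])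
    show "R s {-t..t} \<subseteq> R s UNIV" unfolding R_def by blast
  qed (rule Rm, simp)+
  also have "\<dots> \<le> measure ?P ((space M - G ((t - s) / sqrt 2)) \<times> (space M - G ((t - s) / sqrt 2)))"
  proof (rule P.P.finite_measure_mono)
    show "R s UNIV - R s {-t..t} \<subseteq> (space M - G ((t - s) / sqrt 2)) \<times> (space M - G ((t - s) / sqrt 2))"
    proof
      fix p assume p: "p \<in> R s UNIV - R s {-t..t}"
      then obtain i where i: "i \<in> I" and d: "(X i (fst p) - X i (snd p)) / sqrt 2 \<notin> {-t..t}"
        by (auto simp: R_def)
      let ?a = "X i (fst p)" and ?b = "X i (snd p)"
      have s: "\<bar>(?a + ?b) / sqrt 2\<bar> \<le> s" using p i by (auto simp: R_def abs_le_iff)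
      have d': "t < \<bar>(?a - ?b) / sqrt 2\<bar>" using d unfolding atLeastAtMost_iff by linarith
      have s1: "\<bar>?a + ?b\<bar> \<le> sqrt 2 * s" using s by (simp add: field_simps abs_divide)
      have d1: "sqrt 2 * t < \<bar>?a - ?b\<bar>" using d' by (simp add: field_simps abs_divide)
      \<comment> \<open>Both \<open>2 * \<bar>?a\<bar>\<close> and \<open>2 * \<bar>?b\<bar>\<close>
        are at least \<open>\<bar>?a - ?b\<bar> - \<bar>?a + ?b\<bar>\<close>.\<close>
      have "sqrt 2 * t - sqrt 2 * s < 2 * \<bar>?a\<bar>" "sqrt 2 * t - sqrt 2 * s < 2 * \<bar>?b\<bar>" using s1 d1 by linarith+
      moreover have "2 * ((t - s) / sqrt 2) = sqrt 2 * t - sqrt 2 * s"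
        by (simp add: field_simps)
      ultimately have "(t - s) / sqrt 2 < \<bar>?a\<bar>" "(t - s) / sqrt 2 < \<bar>?b\<bar>" by linarith+
      then have "fst p \<notin> G ((t - s) / sqrt 2)" "snd p \<notin> G ((t - s) / sqrt 2)"
        using i by (auto simp: G_def abs_le_iff) force+
      then show "p \<in> (space M - G ((t - s) / sqrt 2)) \<times> (space M - G ((t - s) / sqrt 2))"
        using p by (auto simp: R_def space_pair_measure mem_Times_iff)
    qed
  qed auto
  also have "\<dots> = (prob (space M - G ((t - s) / sqrt 2)))\<^sup>2"
    using measure_pair_Times by (simp add: power2_eq_square)
  finally show ?thesis unfolding E using prob_compl[OF G] by simp
qed

lemma exceedance_sets:
  assumes "countable I" "\<And>i. i \<in> I \<Longrightarrow> X i \<in> borel_measurable M"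
  shows "{\<omega> \<in> space M. \<exists>i\<in>I. (t :: real) < \<bar>X i \<omega>\<bar>} \<in> events"
proof (rule sets.sets_Collect_countable_Ex'[OF _ assms(1)])
  fix i assume "i \<in> I"
  note [measurable] = assms(2)[OF this]
  show "{\<omega> \<in> space M. t < \<bar>X i \<omega>\<bar>} \<in> events" by measurable
qed

text \<open>The levels \<open>t n\<close> solve \<open>t (n + 1) = s + sqrt 2 * t n\<close> with \<open>t 0 = s\<close>, so that each
  application of \<open>fernique_step\<close> squares the exceedance probability while the level grows
  only by a factor of about \<open>sqrt 2\<close>.\<close>
lemma fernique:
  fixes X :: "'i \<Rightarrow> 'a \<Rightarrow> real"
  assumes I: "countable I" and X: "\<And>i. i \<in> I \<Longrightarrow> X i \<in> H"
    and s: "0 < s" and p: "prob {\<omega> \<in> space M. \<exists>i\<in>I. s < \<bar>X i \<omega>\<bar>} \<le> 1/4" and u: "s \<le> u"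
  shows "prob {\<omega> \<in> space M. \<exists>i\<in>I. u < \<bar>X i \<omega>\<bar>} \<le> exp (- u\<^sup>2 / (24 * s\<^sup>2))"
proof -
  define q where "q t = prob {\<omega> \<in> space M. \<exists>i\<in>I. t < \<bar>X i \<omega>\<bar>}" for t
  define t where "t n = s * (1 + sqrt 2) * (sqrt 2 ^ Suc n - 1)" for n
  have q: "q a \<le> q b" if "b \<le> a" for a b
    unfolding q_def using that I X rv(3) by (intro finite_measure_mono exceedance_sets) force+
  have sq: "sqrt 2 * sqrt 2 = (2::real)" by simp
  have "t 0 = s * (sqrt 2 * sqrt 2 - 1)" by (simp add: t_def algebra_simps)
  then have t0: "t 0 = s" by simp
  have gen: "s * (1 + r) * (r * (r * x) - 1) = s + r * (s * (1 + r) * (r * x - 1))" if "r * r = 2" for r x :: real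
  proof -
    have "r * (r * y) = 2 * y" for y unfolding mult.assoc[symmetric] that ..
    then show ?thesis by (simp add: algebra_simps that)
  qed
  have ts: "(t (Suc n) - s) / sqrt 2 = t n" for n
  proof -
    have "t (Suc n) = s + sqrt 2 * t n"
      unfolding t_def power_Suc by (rule gen[OF sq])
    then show ?thesis by simp
  qed
  \<comment> \<open>The factor 3/4 is a lower bound for \<open>1 - q s\<close>. Relative to it the
    exceedance probabilities start at most at 1/3 and are squared at each step.\<close>
  have bound: "q (t n) \<le> 3/4 * (1/3) ^ (2 ^ n)" for n
  proof (induction n)
    case 0
    then show ?case using p by (simp add: t0 q_def)
  next
    case (Suc n)
    have q0: "0 \<le> q a" for a by (simp add: q_def)
    have "3/4 * q (t (Suc n)) \<le> (1 - q s) * q (t (Suc n))"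
      using p by (intro mult_right_mono q0) (simp add: q_def)
    also have "\<dots> \<le> (q (t n))\<^sup>2"
      using fernique_step[where s = s and t = "t (Suc n)", OF I X] unfolding ts q_def .
    also have "\<dots> \<le> (3/4 * (1/3) ^ (2 ^ n))\<^sup>2"
      by (intro power_mono Suc q0)
    also have "\<dots> = 3/4 * (3/4 * (1/3) ^ (2 ^ Suc n))"
      by (simp add: power2_eq_square mult_2 power_add)
    finally show ?case by simp
  qed
  obtain m where "u / (s * (1 + sqrt 2)) + 1 < sqrt 2 ^ m"
    using real_arch_pow[of "sqrt 2"] by auto
  also have "sqrt 2 ^ m \<le> sqrt 2 ^ Suc m" by (intro power_increasing) auto
  finally have "u / (s * (1 + sqrt 2)) < sqrt 2 ^ Suc m - 1" by linarith
  moreover have "0 < s * (1 + sqrt 2)" using s by (simp add: add_pos_pos)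
  ultimately have "u < t m"
    unfolding t_def by (simp only: pos_divide_less_eq mult.commute)
  then have ex: "\<exists>m. u < t m" by blast
  \<comment> \<open>The least level above \<open>u\<close>: it is not the first, so \<open>u\<close>
    lies between two consecutive levels \<open>t n\<close> and \<open>t (Suc n)\<close>.\<close>
  define m where "m = (LEAST m. u < t m)"
  have m: "u < t m" unfolding m_def using ex by (rule LeastI_ex)
  have "m \<noteq> 0" using m t0 u by (metis not_le)
  then obtain n where n: "m = Suc n" by (cases m) auto
  have tn: "t n \<le> u" using not_less_Least[of n "\<lambda>m. u < t m"] n unfolding m_def[symmetric] by simp
  have "u \<le> s * (1 + sqrt 2) * sqrt 2 ^ Suc m"
    using m s unfolding t_def by (smt (verit) mult_left_mono mult_pos_pos real_sqrt_gt_zero)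
  then have "u\<^sup>2 \<le> (s * (1 + sqrt 2) * sqrt 2 ^ Suc m)\<^sup>2"
    using u s by (intro power_mono) auto
  also have "\<dots> = s\<^sup>2 * (1 + sqrt 2)\<^sup>2 * ((sqrt 2)\<^sup>2) ^ Suc m"
    by (simp only: power_mult_distrib power_mult[symmetric] mult.commute)
  also have "\<dots> = s\<^sup>2 * (3 + 2 * sqrt 2) * 4 * 2 ^ n"
    by (simp add: n power2_eq_square algebra_simps)
  also have "\<dots> \<le> s\<^sup>2 * 6 * 4 * 2 ^ n"
  proof -
    \<comment> \<open>Here \<open>(1 + sqrt 2)^2 = 3 + 2 * sqrt 2\<close> is bounded by 6; the
      factor 4 comes from \<open>Suc m = n + 2\<close>. Their product is the constant 24.\<close>
    have "sqrt 2 \<le> sqrt ((3/2)\<^sup>2)" by (intro real_sqrt_le_mono) (simp add: power2_eq_square)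
    then have "3 + 2 * sqrt 2 \<le> 6" by simp
    then show ?thesis by (intro mult_right_mono mult_left_mono) auto
  qed
  finally have un: "u\<^sup>2 / (24 * s\<^sup>2) \<le> 2 ^ n" using s by (simp add: field_simps)
  have "q u \<le> 3/4 * (1/3) ^ (2 ^ n)" using q[OF tn] bound[of n] by simp
  also have "\<dots> \<le> 1 * (1/3) ^ (2 ^ n)" by (intro mult_right_mono) auto
  \<comment> \<open>This uses that \<open>exp 1\<close> is at most 3.\<close>
  also have "(1/3 :: real) ^ (2 ^ n) \<le> exp (- 1) ^ (2 ^ n)"
    using exp_le by (intro power_mono) (auto simp: exp_minus field_simps)
  also have "exp (- 1 :: real) ^ (2 ^ n) = exp (- (2 ^ n))"
    using exp_of_nat_mult[of "2 ^ n" "- 1 :: real"] by simp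
  also have "\<dots> \<le> exp (- u\<^sup>2 / (24 * s\<^sup>2))" using un by simp
  finally show ?thesis by (simp add: q_def)
qed

text \<open>If \<open>Z t\<close> exceeds \<open>u\<close>, either a nearby net point exceeds
  \<open>(1 - \<eta>) * u\<close> or the increment between them exceeds \<open>\<eta> * u\<close>.
  Finitely many Gaussian tails bound the first case and \<open>fernique\<close> the second.\<close>

lemma concentration:
  fixes Z :: "'t::metric_space \<Rightarrow> 'a \<Rightarrow> real"
  assumes K: "compact K" and cont: "\<And>\<omega>. \<omega> \<in> space M \<Longrightarrow> continuous_on K (\<lambda>t. Z t \<omega>)"
    and T: "countable T" "T \<subseteq> K" and Z: "\<And>t. t \<in> T \<Longrightarrow> Z t \<in> H"
    and var: "\<And>t. t \<in> T \<Longrightarrow> expectation (\<lambda>\<omega>. (Z t \<omega>)\<^sup>2) \<le> \<rho>"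
    and \<tau>: "0 < \<rho>" "\<rho> < \<tau>"
  shows "\<exists>C u0. \<forall>u\<ge>u0. prob {\<omega> \<in> space M. \<exists>t\<in>T. u < \<bar>Z t \<omega>\<bar>} \<le> C * exp (- u\<^sup>2 / (2 * \<tau>))"
proof -
  \<comment> \<open>Chosen so that a variance \<open>\<rho>\<close> at level
    \<open>(1 - \<eta>) * u\<close> gives exactly the exponent
    \<open>- u^2 / (2 * \<tau>)\<close>.\<close>
  define \<eta> where "\<eta> = 1 - sqrt (\<rho> / \<tau>)"
  have "sqrt (\<rho> / \<tau>) < 1" "0 < sqrt (\<rho> / \<tau>)" using \<tau> by auto
  then have \<eta>: "0 < \<eta>" "\<eta> < 1" by (auto simp: \<eta>_def)
  have \<eta>2: "(1 - \<eta>)\<^sup>2 = \<rho> / \<tau>" using \<tau> by (simp add: \<eta>_def)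
  \<comment> \<open>Chosen so that the exponent of \<open>fernique\<close> at level
    \<open>\<eta> * u\<close> is also \<open>- u^2 / (2 * \<tau>)\<close>.\<close>
  define s where "s = \<eta> * sqrt (\<tau> / 12)"
  have s: "0 < s" using \<eta> \<tau> by (simp add: s_def)
  have s2: "s\<^sup>2 = \<eta>\<^sup>2 * \<tau> / 12" using \<tau> by (simp add: s_def power_mult_distrib)
  define J where "J k = {p \<in> T \<times> T. dist (fst p) (snd p) < 1 / real (Suc k)}" for k
  define X where "X p \<omega> = 1 * Z (fst p) \<omega> + (-1) * Z (snd p) \<omega>" for p \<omega>
  have J: "countable (J k)" for k
    by (rule countable_subset[of _ "T \<times> T"]) (use T in \<open>auto simp: J_def\<close>)
  have X: "X p \<in> H" if "p \<in> J k" for p k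
    unfolding X_def[abs_def] using that by (intro comb Z) (auto simp: J_def)
  let ?E = "\<lambda>k. {\<omega> \<in> space M. \<exists>p\<in>J k. s < \<bar>X p \<omega>\<bar>}"
  have lim: "(\<lambda>k. prob (?E k)) \<longlonglongrightarrow> prob (\<Inter>k. ?E k)"
  proof (rule finite_Lim_measure_decseq)
    show "range ?E \<subseteq> events" using J X rv(3) by (auto intro!: exceedance_sets)
    have "J (Suc k) \<subseteq> J k" for k
      by (auto simp: J_def elim!: less_le_trans intro!: divide_left_mono)
    then show "decseq ?E" by (intro decseq_SucI) blast
  qed
  \<comment> \<open>Paths are uniformly continuous on the compact \<open>K\<close>, so none has
    increments above \<open>s\<close> at every scale. The probabilities of \<open>?E k\<close> thus
    tend to 0, and some scale meets the threshold 1/4 of \<open>fernique\<close>.\<close>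
  have empty: "(\<Inter>k. ?E k) = {}"
  proof (rule equals0I)
    fix \<omega> assume \<omega>: "\<omega> \<in> (\<Inter>k. ?E k)"
    then have "uniformly_continuous_on K (\<lambda>t. Z t \<omega>)"
      using compact_uniformly_continuous[OF cont K] by auto
    then obtain d where d: "d > 0" "\<And>x y. x \<in> K \<Longrightarrow> y \<in> K \<Longrightarrow> dist y x < d \<Longrightarrow> dist (Z y \<omega>) (Z x \<omega>) < s"
      using s unfolding uniformly_continuous_on_def by metis
    obtain k where k: "1 / real (Suc k) < d" using d(1) nat_approx_posE by blast
    from \<omega> have "\<omega> \<in> ?E k" by blast
    then obtain p where "p \<in> J k" "s < \<bar>X p \<omega>\<bar>" by blast
    then show False using d(2)[of "snd p" "fst p"] k subsetD[OF T(2)] by (auto simp: J_def X_def dist_real_def)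
  qed
  have "\<forall>\<^sub>F k in sequentially. prob (?E k) < 1/4"
    by (rule order_tendstoD(2)[OF lim]) (simp add: empty)
  then obtain k where k: "prob (?E k) \<le> 1/4"
    by (metis (mono_tags, lifting) eventually_sequentially less_imp_le order_refl)
  define \<epsilon> where "\<epsilon> = 1 / real (Suc k)"
  \<comment> \<open>Covering only \<open>closure T\<close> keeps the centres of the net in
    \<open>T\<close>, where \<open>Z\<close> is known to be Gaussian.\<close>
  have "compact (closure T)"
    using K T by (metis closed_closure closure_minimal compact_Int_closed compact_imp_closed inf.absorb_iff2)
  moreover have "closure T \<subseteq> (\<Union>t\<in>T. ball t \<epsilon>)"
    unfolding closure_approachable by (auto simp: closure_approachable \<epsilon>_def)
  ultimately obtain P where P: "P \<subseteq> T" "finite P" and cover: "closure T \<subseteq> (\<Union>t\<in>P. ball t \<epsilon>)"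
    using compactE_image[of "closure T" T "\<lambda>t. ball t \<epsilon>"] by (metis open_ball)
  have meas: "{\<omega> \<in> space M. a < \<bar>Z t \<omega>\<bar>} \<in> events" if "t \<in> T" for t a
    using exceedance_sets[of "{t}" Z a] rv(3)[OF Z[OF that]] by simp
  \<comment> \<open>For \<open>u\<close> from \<open>s / \<eta>\<close> on, the level
    \<open>\<eta> * u\<close> is at least \<open>s\<close>, as \<open>fernique\<close>
    demands.\<close>
  have main: "prob {\<omega> \<in> space M. \<exists>t\<in>T. u < \<bar>Z t \<omega>\<bar>} \<le> (2 * card P + 1) * exp (- u\<^sup>2 / (2 * \<tau>))"
    if u: "u \<ge> s / \<eta>" for u
  proof -
    have u0: "0 \<le> u" using u s \<eta> by (smt (verit) divide_pos_pos)
    let ?A = "\<lambda>p. {\<omega> \<in> space M. (1 - \<eta>) * u < \<bar>Z p \<omega>\<bar>}" and ?B = "{\<omega> \<in> space M. \<exists>p\<in>J k. \<eta> * u < \<bar>X p \<omega>\<bar>}"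
    have "{\<omega> \<in> space M. \<exists>t\<in>T. u < \<bar>Z t \<omega>\<bar>} \<subseteq> (\<Union>p\<in>P. ?A p) \<union> ?B"
    proof
      fix \<omega> assume "\<omega> \<in> {\<omega> \<in> space M. \<exists>t\<in>T. u < \<bar>Z t \<omega>\<bar>}"
      then obtain t where \<omega>: "\<omega> \<in> space M" and t: "t \<in> T" "u < \<bar>Z t \<omega>\<bar>" by auto
      then obtain p where p: "p \<in> P" "dist p t < \<epsilon>" using cover closure_subset[of T] by fastforce
      have "u = (1 - \<eta>) * u + \<eta> * u" by (simp add: algebra_simps)
      then have "(1 - \<eta>) * u < \<bar>Z p \<omega>\<bar> \<or> \<eta> * u < \<bar>X (t, p) \<omega>\<bar>"
        using t(2) unfolding X_def fst_conv snd_conv by linarith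
      moreover have "(t, p) \<in> J k" using t p P by (auto simp: J_def \<epsilon>_def dist_commute)
      ultimately show "\<omega> \<in> (\<Union>p\<in>P. ?A p) \<union> ?B" using \<omega> p by blast
    qed
    then have "prob {\<omega> \<in> space M. \<exists>t\<in>T. u < \<bar>Z t \<omega>\<bar>} \<le> prob ((\<Union>p\<in>P. ?A p) \<union> ?B)"
      using P J X rv(3) meas by (intro finite_measure_mono sets.Un sets.finite_UN exceedance_sets) auto
    also have "\<dots> \<le> prob (\<Union>p\<in>P. ?A p) + prob ?B"
      using P J X rv(3) meas by (intro measure_Un_le sets.finite_UN exceedance_sets) auto
    also have "prob (\<Union>p\<in>P. ?A p) \<le> (\<Sum>p\<in>P. prob (?A p))"
      using P meas by (intro finite_measure_subadditive_finite) auto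
    also have "\<dots> \<le> (\<Sum>p\<in>P. 2 * exp (- u\<^sup>2 / (2 * \<tau>)))"
    proof (rule sum_mono)
      fix p assume "p \<in> P"
      then have p: "p \<in> T" using P by auto
      have "prob (?A p) \<le> 2 * exp (- ((1 - \<eta>) * u)\<^sup>2 / (2 * \<rho>))"
        using u0 \<eta> by (intro centered_gaussian_rv_tail_le[OF prob_space_axioms rv(1)[OF Z[OF p]] var[OF p] \<tau>(1)]) auto
      also have "- ((1 - \<eta>) * u)\<^sup>2 / (2 * \<rho>) = - u\<^sup>2 / (2 * \<tau>)"
        unfolding power_mult_distrib \<eta>2 using \<tau> by (simp add: field_simps)
      finally show "prob (?A p) \<le> 2 * exp (- u\<^sup>2 / (2 * \<tau>))" .
    qed
    also have "prob ?B \<le> exp (- (\<eta> * u)\<^sup>2 / (24 * s\<^sup>2))"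
      using u \<eta> by (intro fernique[OF J X s k]) (auto simp: field_simps)
    also have "- (\<eta> * u)\<^sup>2 / (24 * s\<^sup>2) = - u\<^sup>2 / (2 * \<tau>)"
      unfolding power_mult_distrib s2 using \<eta> \<tau> by (simp add: field_simps)
    finally show ?thesis by (simp add: algebra_simps)
  qed
  show ?thesis
    using main by blast
qed

end

section \<open>The Brownian sheet\<close>

lemma (in gaussian_space) integrable_mult:
  assumes X: "X \<in> H" and Y: "Y \<in> H"
  shows "integrable M (\<lambda>\<omega>. X \<omega> * Y \<omega>)"
proof -
  have "integrable M (\<lambda>\<omega>. ((1 * X \<omega> + 1 * Y \<omega>)\<^sup>2 - (X \<omega>)\<^sup>2 - (Y \<omega>)\<^sup>2) / 2)"
    using rv(2)[OF X] rv(2)[OF Y] rv(2)[OF comb[OF X Y]] by (intro integrable_divide Bochner_Integration.integrable_diff)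
  then show ?thesis by (simp add: power2_eq_square algebra_simps)
qed

lemma One_nth: "(One :: real^'n) $ i = 1"
  using inner_sum_left_Basis[of "axis i 1 :: real^'n" "\<lambda>_. 1"]
  by (simp add: axis_in_Basis_iff cart_eq_inner_axis del: inner_sum_left_Basis)

lemma mem_unit_cube: "x \<in> unit_cube \<longleftrightarrow> (\<forall>i. 0 \<le> x $ i \<and> x $ i \<le> 1)"
  unfolding mem_box_cart One_nth by simp

lemma meet_simps:
  "meet x x = x" "meet x y = meet y x" "x \<in> unit_cube \<Longrightarrow> meet x One = x" "x \<in> unit_cube \<Longrightarrow> meet One x = x"
  "x \<in> unit_cube \<Longrightarrow> y \<in> unit_cube \<Longrightarrow> meet x y \<in> unit_cube" "One \<in> unit_cube"
  unfolding mem_unit_cube meet_def by (auto simp: vec_eq_iff One_nth min_def intro: antisym simp del: sum_component)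

lemma distribution_function_cube_bounds:
  assumes "distribution_function_cube F"
  shows "x \<in> unit_cube \<Longrightarrow> 0 \<le> F x" "x \<in> unit_cube \<Longrightarrow> F x \<le> 1" "F One = 1"
proof -
  obtain \<mu> where \<mu>: "sets \<mu> = sets borel" "prob_space \<mu>" "emeasure \<mu> (UNIV - unit_cube) = 0"
    "\<And>x. x \<in> unit_cube \<Longrightarrow> F x = measure \<mu> (cbox 0 x)"
    using assms unfolding distribution_function_cube_def by blast
  interpret prob_space \<mu> by fact
  show "x \<in> unit_cube \<Longrightarrow> 0 \<le> F x" "x \<in> unit_cube \<Longrightarrow> F x \<le> 1" using \<mu>(4) by auto
  have sp: "space \<mu> = UNIV" using \<mu>(1) sets_eq_imp_space_eq by fastforce
  have "prob (space \<mu> - unit_cube) = 0" using \<mu>(3) by (simp add: measure_def sp)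
  then have "prob unit_cube = 1" using prob_compl[of unit_cube] \<mu>(1) by simp
  then show "F One = 1" using \<mu>(4) meet_simps(6) by metis
qed

text \<open>Finite combinations are what \<open>brownian_sheet\<close> declares Gaussian, so for the
  sheet this span serves as the \<open>H\<close> of \<open>gaussian_space\<close>.\<close>

definition linear_span_rv :: "'b set \<Rightarrow> ('b \<Rightarrow> 'a \<Rightarrow> real) \<Rightarrow> ('a \<Rightarrow> real) set" where
  "linear_span_rv T W = {Y. \<exists>S c. finite S \<and> S \<subseteq> T \<and> Y = (\<lambda>\<omega>. \<Sum>x\<in>S. c x * W x \<omega>)}"

lemma linear_span_rv_base:
  assumes "x \<in> T" shows "W x \<in> linear_span_rv T W"
  unfolding linear_span_rv_def using assms by (auto intro!: exI[of _ "{x}"] exI[of _ "\<lambda>_. 1"])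

lemma linear_span_rv_comb:
  assumes "X \<in> linear_span_rv T W" "Y \<in> linear_span_rv T W"
  shows "(\<lambda>\<omega>. a * X \<omega> + b * Y \<omega>) \<in> linear_span_rv T W"
proof -
  obtain S c where S: "finite S" "S \<subseteq> T" "X = (\<lambda>\<omega>. \<Sum>x\<in>S. c x * W x \<omega>)"
    using assms(1) by (auto simp: linear_span_rv_def)
  obtain R d where R: "finite R" "R \<subseteq> T" "Y = (\<lambda>\<omega>. \<Sum>x\<in>R. d x * W x \<omega>)"
    using assms(2) by (auto simp: linear_span_rv_def)
  let ?e = "\<lambda>x. (if x \<in> S then a * c x else 0) + (if x \<in> R then b * d x else 0)"
  have "a * X \<omega> + b * Y \<omega> = (\<Sum>x\<in>S \<union> R. ?e x * W x \<omega>)" for \<omega>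
  proof -
    have "(\<Sum>x\<in>S \<union> R. ?e x * W x \<omega>)
        = (\<Sum>x\<in>S \<union> R. if x \<in> S then a * (c x * W x \<omega>) else 0) + (\<Sum>x\<in>S \<union> R. if x \<in> R then b * (d x * W x \<omega>) else 0)"
      unfolding sum.distrib[symmetric] by (intro sum.cong) (auto simp: algebra_simps)
    also have "(\<Sum>x\<in>S \<union> R. if x \<in> S then a * (c x * W x \<omega>) else 0) = (\<Sum>x\<in>S. a * (c x * W x \<omega>))"
      using S R by (intro sum.mono_neutral_cong_right) auto
    also have "(\<Sum>x\<in>S \<union> R. if x \<in> R then b * (d x * W x \<omega>) else 0) = (\<Sum>x\<in>R. b * (d x * W x \<omega>))"
      using S R by (intro sum.mono_neutral_cong_right) auto
    finally show ?thesis by (simp add: S(3) R(3) sum_distrib_left)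
  qed
  then show ?thesis
    unfolding linear_span_rv_def using S R by (intro CollectI exI[of _ "S \<union> R"] exI[of _ ?e]) auto
qed

lemma brownian_sheet_gaussian_space:
  assumes "brownian_sheet M F W"
  shows "gaussian_space M (linear_span_rv unit_cube W)"
proof -
  interpret prob_space M using assms by (simp add: brownian_sheet_def)
  show ?thesis
  proof
    show "(\<lambda>_. 0) \<in> linear_span_rv unit_cube W"
      unfolding linear_span_rv_def by (auto intro!: exI[of _ "{}"])
  next
    fix X assume "X \<in> linear_span_rv unit_cube W"
    then obtain S c where "finite S" "S \<subseteq> unit_cube" "X = (\<lambda>\<omega>. \<Sum>x\<in>S. c x * W x \<omega>)"
      by (auto simp: linear_span_rv_def)
    then show "\<exists>v. centered_gaussian_rv M X v"
      using assms unfolding brownian_sheet_def by blast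
  qed (rule linear_span_rv_comb)
qed

text \<open>Polarization: the variances of \<open>W x\<close>, \<open>W y\<close> and
  \<open>W x + W y\<close> determine the mixed moment.\<close>

lemma brownian_sheet_covariance:
  assumes sheet: "brownian_sheet M F W" and x: "x \<in> unit_cube" and y: "y \<in> unit_cube"
  shows "(LINT \<omega>|M. W x \<omega> * W y \<omega>) = F (meet x y)"
proof -
  interpret gaussian_space M "linear_span_rv unit_cube W"
    by (rule brownian_sheet_gaussian_space[OF sheet])
  have mom: "expectation (\<lambda>\<omega>. (\<Sum>x\<in>S. c x * W x \<omega>)\<^sup>2) = (\<Sum>x\<in>S. \<Sum>y\<in>S. c x * c y * F (meet x y))"
    if "finite S" "S \<subseteq> unit_cube" for S c
    using sheet that unfolding brownian_sheet_def
    by (intro centered_gaussian_rv_second_moment(2)[OF prob_space_axioms]) blast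
  have sq: "expectation (\<lambda>\<omega>. (W z \<omega>)\<^sup>2) = F z" if "z \<in> unit_cube" for z
    using mom[of "{z}" "\<lambda>_. 1"] that by (simp add: meet_simps)
  note H = linear_span_rv_base[OF x, of W] linear_span_rv_base[OF y, of W]
  show ?thesis
  \<comment> \<open>For equal points the set \<open>{x, y}\<close> is a singleton and no longer
    encodes the sum of two terms.\<close>
  proof (cases "x = y")
    case True
    then show ?thesis using sq[OF y] by (simp add: meet_simps power2_eq_square)
  next
    case False
    have "F x + F y + 2 * F (meet x y) = expectation (\<lambda>\<omega>. (W x \<omega> + W y \<omega>)\<^sup>2)"
      using mom[of "{x, y}" "\<lambda>_. 1"] x y False by (simp add: meet_simps(1) meet_simps(2)[of y x])
    also have "\<dots> = expectation (\<lambda>\<omega>. (W x \<omega>)\<^sup>2 + (W y \<omega>)\<^sup>2 + 2 * (W x \<omega> * W y \<omega>))"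
      by (intro Bochner_Integration.integral_cong) (auto simp: power2_eq_square algebra_simps)
    also have "\<dots> = F x + F y + 2 * expectation (\<lambda>\<omega>. W x \<omega> * W y \<omega>)"
      using rv(2)[OF H(1)] rv(2)[OF H(2)] integrable_mult[OF H] sq[OF x] sq[OF y] by simp
    finally show ?thesis by simp
  qed
qed

text \<open>Three points suffice for the bridge and its increments, which involve
  \<open>W x\<close>, \<open>W y\<close> and \<open>W One\<close>.\<close>

lemma brownian_sheet_comb_variance:
  assumes sheet: "brownian_sheet M F W" and x: "x \<in> unit_cube" and y: "y \<in> unit_cube" and z: "z \<in> unit_cube"
  shows "(LINT \<omega>|M. (W x \<omega> + b * W y \<omega> + c * W z \<omega>)\<^sup>2)
    = F x + b\<^sup>2 * F y + c\<^sup>2 * F z + 2 * b * F (meet x y) + 2 * c * F (meet x z) + 2 * b * c * F (meet y z)"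
proof -
  interpret gaussian_space M "linear_span_rv unit_cube W"
    by (rule brownian_sheet_gaussian_space[OF sheet])
  note H = linear_span_rv_base[OF x, of W] linear_span_rv_base[OF y, of W] linear_span_rv_base[OF z, of W]
  note i = integrable_mult[OF H(1) H(1)] integrable_mult[OF H(2) H(2)] integrable_mult[OF H(3) H(3)]
    integrable_mult[OF H(1) H(2)] integrable_mult[OF H(1) H(3)] integrable_mult[OF H(2) H(3)]
  have "expectation (\<lambda>\<omega>. (W x \<omega> + b * W y \<omega> + c * W z \<omega>)\<^sup>2)
    = expectation (\<lambda>\<omega>. W x \<omega> * W x \<omega> + b\<^sup>2 * (W y \<omega> * W y \<omega>) + c\<^sup>2 * (W z \<omega> * W z \<omega>)
      + 2 * b * (W x \<omega> * W y \<omega>) + 2 * c * (W x \<omega> * W z \<omega>) + 2 * b * c * (W y \<omega> * W z \<omega>))"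
    by (intro Bochner_Integration.integral_cong) (auto simp: power2_eq_square algebra_simps)
  also have "\<dots> = F (meet x x) + b\<^sup>2 * F (meet y y) + c\<^sup>2 * F (meet z z) + 2 * b * F (meet x y) + 2 * c * F (meet x z) + 2 * b * c * F (meet y z)"
    using i by (simp add: brownian_sheet_covariance[OF sheet] x y z)
  finally show ?thesis by (simp add: meet_simps(1))
qed

text \<open>Exceeding \<open>u\<close> is an open condition, so a point of \<open>E\<close> where
  \<open>f\<close> exceeds \<open>u\<close> has points of \<open>T\<close> nearby where it still
  does. Compactness of \<open>K\<close> bounds \<open>f\<close>, which makes the real-valued
  \<open>SUP\<close> a genuine supremum.\<close>

lemma less_SUP_iff_dense:
  fixes f :: "'b::metric_space \<Rightarrow> real"
  assumes K: "compact K" "continuous_on K f" and E: "E \<subseteq> K" "E \<noteq> {}" and T: "T \<subseteq> E" "E \<subseteq> closure T"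
  shows "u < (SUP x\<in>E. f x) \<longleftrightarrow> (\<exists>x\<in>T. u < f x)"
proof -
  have "bdd_above (f ` K)"
    using K by (intro bounded_imp_bdd_above compact_imp_bounded compact_continuous_image)
  then have "bdd_above (f ` E)" using E by (meson bdd_above_mono image_mono)
  then have "u < (SUP x\<in>E. f x) \<longleftrightarrow> (\<exists>x\<in>E. u < f x)" using E by (simp add: less_cSUP_iff)
  also have "\<dots> \<longleftrightarrow> (\<exists>x\<in>T. u < f x)"
  proof
    assume "\<exists>x\<in>E. u < f x"
    then obtain x where x: "x \<in> E" "u < f x" by auto
    then obtain d where d: "d > 0" "\<And>y. y \<in> K \<Longrightarrow> dist y x < d \<Longrightarrow> dist (f y) (f x) < f x - u"
      using K(2) E unfolding continuous_on_iff by (metis diff_gt_0_iff_gt subsetD)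
    obtain y where y: "y \<in> T" "dist y x < d"
      using x T d(1) by (meson closure_approachable subsetD)
    then have "dist (f y) (f x) < f x - u" using d(2) T E by blast
    then have "u < f y" by (auto simp: dist_real_def)
    then show "\<exists>x\<in>T. u < f x" using y by blast
  qed (use T in blast)
  finally show ?thesis .
qed

text \<open>A larger quadratic coefficient wins whatever the shifts: the linear terms they cause are
  of lower order.\<close>

lemma tendsto_exp_quadratic_dominated:
  fixes \<kappa> a b :: real
  assumes "2 < \<kappa>"
  shows "((\<lambda>u. exp (- \<kappa> * (u - a)\<^sup>2) / exp (- 2 * (u + b)\<^sup>2)) \<longlongrightarrow> 0) at_top"
proof (rule Lim_null_comparison)
  \<comment> \<open>The exponent of the quotient is \<open>- k * u^2 + l * u + m\<close>.\<close>
  define k l m where "k = \<kappa> - 2" and "l = 2 * \<kappa> * a + 4 * b" and "m = 2 * b\<^sup>2 - \<kappa> * a\<^sup>2"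
  show "((\<lambda>u::real. exp (- u)) \<longlongrightarrow> 0) at_top"
    by (intro filterlim_compose[OF exp_at_bot filterlim_uminus_at_bot_at_top])
  show "\<forall>\<^sub>F u in at_top. norm (exp (- \<kappa> * (u - a)\<^sup>2) / exp (- 2 * (u + b)\<^sup>2)) \<le> exp (- u)"
    \<comment> \<open>Past the second threshold \<open>k * u\<close> is at least
      \<open>\<bar>l\<bar> + 1 + \<bar>m\<bar>\<close>; the 1 leaves room for the extra
      \<open>- u\<close>.\<close>
    using eventually_ge_at_top[of 1] eventually_ge_at_top[of "(\<bar>l\<bar> + 1 + \<bar>m\<bar>) / k"]
  proof eventually_elim
    case (elim u)
    have "\<bar>l\<bar> + 1 + \<bar>m\<bar> \<le> k * u" using elim(2) assms by (simp add: field_simps k_def)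
    then have "(\<bar>l\<bar> + 1 + \<bar>m\<bar>) * u \<le> k * u * u" using elim(1) by (intro mult_right_mono) auto
    moreover have "\<bar>m\<bar> * 1 \<le> \<bar>m\<bar> * u" using elim(1) by (intro mult_left_mono) auto
    moreover have "l * u \<le> \<bar>l\<bar> * u" using elim(1) by (intro mult_right_mono) auto
    moreover have "m \<le> \<bar>m\<bar>" by simp
    ultimately have "l * u + m + u \<le> k * u * u"
      unfolding distrib_right[of "\<bar>l\<bar> + 1"] distrib_right[of "\<bar>l\<bar>" 1] by linarith
    then have "- \<kappa> * (u - a)\<^sup>2 - (- 2 * (u + b)\<^sup>2) \<le> - u"
      by (simp add: power2_eq_square algebra_simps k_def l_def m_def)
    then have "exp (- \<kappa> * (u - a)\<^sup>2 - (- 2 * (u + b)\<^sup>2)) \<le> exp (- u)" by simp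
    then show ?case by (simp only: exp_diff real_norm_def abs_divide abs_exp_cancel)
  qed
qed

theorem theorem2p5:
  fixes F :: "real^'n \<Rightarrow> real"
    and E :: "(real^'n) set"
    and x0 :: "real^'n"
    and \<delta> :: real
    and M :: "'a measure"
    and W :: "real^'n \<Rightarrow> 'a \<Rightarrow> real"
    and w :: real
  assumes "distribution_function_cube F"
    and "continuous_on unit_cube F"
    and "E \<subseteq> unit_cube"
    and "x0 \<in> E" and "F x0 = 1/2"
    and "0 < \<delta>" and "\<delta> < 1/4"
    and "\<delta> < (INF x\<in>{z\<in>E. 1/2 - \<delta> \<le> F z \<and> F z \<le> 1/2 + \<delta>}.
                INF y\<in>{z\<in>E. 1/2 - \<delta> \<le> F z \<and> F z \<le> 1/2 + \<delta>}. F (meet x y))"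
    and "brownian_sheet M F W"
  shows "(\<lambda>u. cond_sup_abs_prob M F W E w u) \<sim>[at_top]
         (\<lambda>u. cond_sup_prob M F W E w u + cond_sup_prob M F W E (- w) u)"
proof -
  note df = assms(1) and contF = assms(2) and E = assms(3) and x0 = assms(4,5) and \<delta> = assms(6,7)
    and inf = assms(8) and sheet = assms(9)
  interpret gaussian_space M "linear_span_rv unit_cube W"
    by (rule brownian_sheet_gaussian_space[OF sheet])

  \<comment> \<open>The bridge field and its covariance\<close>
  define D where "D = {z\<in>E. 1/2 - \<delta> \<le> F z \<and> F z \<le> 1/2 + \<delta>}"
  define \<delta>' where "\<delta>' = (INF x\<in>D. INF y\<in>D. F (meet x y))"
  \<comment> \<open>The bridge of \<open>W\<close>, which is the conditional field for the value 0;
    adding \<open>F x * v\<close> gives the one for \<open>v\<close>.\<close>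
  define B where "B x \<omega> = W x \<omega> + (- F x) * W One \<omega>" for x \<omega>
  note F01 = distribution_function_cube_bounds[OF df]
  have cube: "(One :: real^'n) \<in> unit_cube" by (rule meet_simps)
  have DE: "D \<subseteq> unit_cube" using E by (auto simp: D_def)
  have x0D: "x0 \<in> D" using x0 \<delta> by (auto simp: D_def)
  have x0c: "x0 \<in> unit_cube" using x0 E by auto
  have \<delta>': "\<delta> < \<delta>'" using inf by (simp add: \<delta>'_def D_def)
  \<comment> \<open>Nonnegativity of \<open>F\<close> bounds the nested infima below, and
    \<open>x0\<close> makes \<open>D\<close> nonempty; so the infima behave as true lower
    bounds.\<close>
  have F0: "0 \<le> F (meet x y)" if "x \<in> D" "y \<in> D" for x y
    using that DE by (intro F01 meet_simps) auto
  have bdd: "bdd_below ((\<lambda>y. F (meet x y)) ` D)" if "x \<in> D" for x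
    using F0 that by (intro bdd_belowI[of _ 0]) auto
  have inner0: "0 \<le> (INF y\<in>D. F (meet x y))" if "x \<in> D" for x
    using x0D F0 that by (intro cINF_greatest) auto
  have cov: "\<delta>' \<le> F (meet x y)" if "x \<in> D" "y \<in> D" for x y
  proof -
    have "\<delta>' \<le> (INF y\<in>D. F (meet x y))"
      unfolding \<delta>'_def using inner0 that by (intro cINF_lower bdd_belowI[of _ 0]) auto
    also have "\<dots> \<le> F (meet x y)" using bdd that by (intro cINF_lower) auto
    finally show ?thesis .
  qed
  have \<delta>'_le: "\<delta>' \<le> 1/2" using cov[OF x0D x0D] x0 by (simp add: meet_simps)

  have BH: "B x \<in> linear_span_rv unit_cube W" if "x \<in> unit_cube" for x
    using comb[OF linear_span_rv_base[OF that] linear_span_rv_base[OF cube], of 1 "- F x"]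
    unfolding B_def[abs_def] by simp
  have contB: "continuous_on unit_cube (\<lambda>x. B x \<omega>)" if "\<omega> \<in> space M" for \<omega>
    using sheet that contF unfolding brownian_sheet_def B_def by (intro continuous_intros) auto
  have varB: "expectation (\<lambda>\<omega>. (B x \<omega>)\<^sup>2) = F x * (1 - F x)" if x: "x \<in> unit_cube" for x
    using brownian_sheet_comb_variance[OF sheet x cube cube, of "- F x" 0] F01(3) x
    unfolding B_def by (simp add: meet_simps power2_eq_square algebra_simps)
  \<comment> \<open>The increment is the combination of \<open>W x\<close>, \<open>W y\<close> and
    \<open>W One\<close> with coefficients 1, -1 and \<open>F y - F x\<close>.\<close>
  have varBB: "expectation (\<lambda>\<omega>. (B x \<omega> - B y \<omega>)\<^sup>2) = F x + F y - 2 * F (meet x y) - (F x - F y)\<^sup>2"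
    if x: "x \<in> unit_cube" and y: "y \<in> unit_cube" for x y
  proof -
    have "expectation (\<lambda>\<omega>. (B x \<omega> - B y \<omega>)\<^sup>2)
        = expectation (\<lambda>\<omega>. (W x \<omega> + (- 1) * W y \<omega> + (F y - F x) * W One \<omega>)\<^sup>2)"
      unfolding B_def by (simp add: algebra_simps)
    then show ?thesis
      using brownian_sheet_comb_variance[OF sheet x y cube, of "- 1" "F y - F x"] F01(3) x y
      by (simp add: meet_simps(1,3,4) power2_eq_square algebra_simps)
  qed

  \<comment> \<open>Reduction to a countable set and to the two one-sided events\<close>
  obtain T0 where T0: "countable T0" "T0 \<subseteq> E" "E \<subseteq> closure T0" using separable[of E] by metis
  \<comment> \<open>The point \<open>x0\<close> is added because the lower bound evaluates the field
    there.\<close>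
  define T where "T = insert x0 T0"
  have T: "countable T" "T \<subseteq> E" "E \<subseteq> closure T"
    using T0 x0 closure_mono[of T0 T] by (auto simp: T_def)
  have Tc: "T \<subseteq> unit_cube" using T E by auto
  have x0T: "x0 \<in> T" by (simp add: T_def)
  define P where "P v u = {\<omega> \<in> space M. \<exists>x\<in>T. u < B x \<omega> + F x * v}" for v u
  define N where "N v u = {\<omega> \<in> space M. \<exists>x\<in>T. u < - (B x \<omega> + F x * v)}" for v u
  have cP: "cond_sup_prob M F W E v u = prob (P v u)" for v u
  proof -
    have "u < (SUP x\<in>E. W x \<omega> - F x * W One \<omega> + F x * v) \<longleftrightarrow> (\<exists>x\<in>T. u < W x \<omega> - F x * W One \<omega> + F x * v)"
      if "\<omega> \<in> space M" for \<omega>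
      using contB[OF that] contF x0(1)
      by (intro less_SUP_iff_dense[OF compact_cbox _ E _ T(2,3)]) (auto simp: B_def intro!: continuous_intros)
    then show ?thesis unfolding cond_sup_prob_def P_def B_def
      by (intro arg_cong[where f=prob]) auto
  qed
  have cN: "cond_sup_abs_prob M F W E v u = prob (P v u \<union> N v u)" for v u
  proof -
    have "u < (SUP x\<in>E. \<bar>W x \<omega> - F x * W One \<omega> + F x * v\<bar>) \<longleftrightarrow> (\<exists>x\<in>T. u < \<bar>W x \<omega> - F x * W One \<omega> + F x * v\<bar>)"
      if "\<omega> \<in> space M" for \<omega>
      using contB[OF that] contF x0(1)
      by (intro less_SUP_iff_dense[OF compact_cbox _ E _ T(2,3)]) (auto simp: B_def intro!: continuous_intros)
    moreover have "u < \<bar>y\<bar> \<longleftrightarrow> u < y \<or> u < - y" for y :: real by linarith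
    ultimately show ?thesis unfolding cond_sup_abs_prob_def P_def N_def B_def
      by (intro arg_cong[where f=prob]) auto
  qed
  have mB: "B x \<in> borel_measurable M" if "x \<in> T" for x
    using rv(3)[OF BH] that Tc by auto
  have mP: "P v u \<in> events" and mN: "N v u \<in> events" for v u
  proof -
    have "{\<omega> \<in> space M. u < B x \<omega> + F x * v} \<in> events" "{\<omega> \<in> space M. u < - (B x \<omega> + F x * v)} \<in> events" if "x \<in> T" for x
    proof -
      note [measurable] = mB[OF that]
      show "{\<omega> \<in> space M. u < B x \<omega> + F x * v} \<in> events" "{\<omega> \<in> space M. u < - (B x \<omega> + F x * v)} \<in> events"
        by measurable
    qed
    then show "P v u \<in> events" "N v u \<in> events" unfolding P_def N_def
      by (auto intro!: sets.sets_Collect_countable_Ex'[OF _ T(1)])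
  qed
  \<comment> \<open>The complements are rectangles with the same bounds \<open>u + F x * w\<close>,
    one for \<open>B\<close> and one for \<open>- B\<close>.\<close>
  have sym: "prob (N w u) = prob (P (- w) u)" for u
  proof -
    have "prob {\<omega> \<in> space M. \<forall>x\<in>T. B x \<omega> \<in> {..u + F x * w}} = prob {\<omega> \<in> space M. \<forall>x\<in>T. - B x \<omega> \<in> {..u + F x * w}}"
      by (rule symmetric_law[OF T(1)]) (use BH Tc in auto)
    moreover have "{\<omega> \<in> space M. \<forall>x\<in>T. B x \<omega> \<in> {..u + F x * w}} = space M - P (- w) u"
      "{\<omega> \<in> space M. \<forall>x\<in>T. - B x \<omega> \<in> {..u + F x * w}} = space M - N w u"
      by (auto simp: P_def N_def not_less algebra_simps)
    ultimately show ?thesis using prob_compl[OF mP] prob_compl[OF mN] by simp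
  qed
  define Q where "Q u = prob (P w u \<inter> N w u)" for u
  define S where "S u = prob (P w u) + prob (P (- w) u)" for u
  \<comment> \<open>After the symmetry, only the overlap \<open>Q\<close> separates the two sides of
    the claim.\<close>
  have incl_excl: "prob (P w u \<union> N w u) = S u - Q u" for u
    unfolding S_def Q_def sym[symmetric] using mP mN
    by (simp add: finite_measure_Union' finite_measure_Diff' Int_commute)

  \<comment> \<open>Tail bounds outside of \<open>D\<close> and for increments within
    \<open>D\<close>\<close>
  have d2: "0 < \<delta>\<^sup>2" "\<delta>\<^sup>2 < 1/4" using \<delta> mult_strict_mono[of \<delta> "1/4" \<delta> 1] by (auto simp: power2_eq_square)
  \<comment> \<open>Outside of \<open>D\<close> the variance \<open>1/4 - (F x - 1/2)^2\<close> is
    at most \<open>1/4 - \<delta>^2\<close>. The value \<open>1/4 - \<delta>^2/2\<close> lies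
    strictly between this and 1/4.\<close>
  obtain C1 u1 where C1: "\<And>u. u \<ge> u1 \<Longrightarrow> prob {\<omega> \<in> space M. \<exists>x\<in>T - D. u < \<bar>B x \<omega>\<bar>} \<le> C1 * exp (- u\<^sup>2 / (2 * (1/4 - \<delta>\<^sup>2/2)))"
  proof -
    have "expectation (\<lambda>\<omega>. (B x \<omega>)\<^sup>2) \<le> 1/4 - \<delta>\<^sup>2" if "x \<in> T - D" for x
    proof -
      have "\<delta> < \<bar>F x - 1/2\<bar>" using that T by (auto simp: D_def)
      then have "\<delta>\<^sup>2 \<le> (F x - 1/2)\<^sup>2" using \<delta> by (metis abs_le_square_iff abs_of_pos less_imp_le)
      moreover have "expectation (\<lambda>\<omega>. (B x \<omega>)\<^sup>2) = F x * (1 - F x)" using varB that Tc by auto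
      ultimately show ?thesis by (simp add: power2_eq_square algebra_simps)
    qed
    then have "\<exists>C u0. \<forall>u\<ge>u0. prob {\<omega> \<in> space M. \<exists>x\<in>T - D. u < \<bar>B x \<omega>\<bar>} \<le> C * exp (- u\<^sup>2 / (2 * (1/4 - \<delta>\<^sup>2/2)))"
      using T Tc BH d2 by (intro concentration[OF compact_cbox contB, where \<rho> = "1/4 - \<delta>\<^sup>2"]) auto
    then show ?thesis using that by blast
  qed
  \<comment> \<open>On \<open>D\<close> one has \<open>F x + F y \<le> 1 + 2 * \<delta>\<close> and
    \<open>F (meet x y) \<ge> \<delta>'\<close>, which bounds the variance of increments; it stays
    below 1 because \<open>\<delta> < \<delta>'\<close>.\<close>
  define \<sigma>2 where "\<sigma>2 = 1 + 2 * \<delta> - 2 * \<delta>'"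
  have \<sigma>2: "0 < \<sigma>2" "\<sigma>2 < 1" using \<delta>' \<delta>'_le \<delta> by (auto simp: \<sigma>2_def)
  define \<Delta> where "\<Delta> p \<omega> = B (fst p) \<omega> - B (snd p) \<omega>" for p \<omega>
  \<comment> \<open>The field of increments is indexed by pairs over the compact product cube;
    \<open>(1 + \<sigma>2) / 2\<close> lies strictly between \<open>\<sigma>2\<close> and 1.\<close>
  obtain C2 u2 where C2: "\<And>u. u \<ge> u2 \<Longrightarrow> prob {\<omega> \<in> space M. \<exists>p\<in>(T \<inter> D) \<times> (T \<inter> D). u < \<bar>\<Delta> p \<omega>\<bar>}
      \<le> C2 * exp (- u\<^sup>2 / (2 * ((1 + \<sigma>2) / 2)))"
  proof -
    have "\<exists>C u0. \<forall>u\<ge>u0. prob {\<omega> \<in> space M. \<exists>p\<in>(T \<inter> D) \<times> (T \<inter> D). u < \<bar>\<Delta> p \<omega>\<bar>} \<le> C * exp (- u\<^sup>2 / (2 * ((1 + \<sigma>2) / 2)))"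
    proof (rule concentration)
      show "compact (unit_cube \<times> unit_cube :: ((real^'n) \<times> (real^'n)) set)" by (intro compact_Times compact_cbox)
      show "continuous_on (unit_cube \<times> unit_cube) (\<lambda>p. \<Delta> p \<omega>)" if "\<omega> \<in> space M" for \<omega>
        unfolding \<Delta>_def
        by (intro continuous_on_diff continuous_on_compose2[OF contB[OF that]] continuous_intros) auto
      show "countable ((T \<inter> D) \<times> (T \<inter> D))" using T by auto
      show "(T \<inter> D) \<times> (T \<inter> D) \<subseteq> unit_cube \<times> unit_cube" using Tc by auto
      fix p assume "p \<in> (T \<inter> D) \<times> (T \<inter> D)"
      then have p: "fst p \<in> D" "snd p \<in> D" "fst p \<in> unit_cube" "snd p \<in> unit_cube" using DE by auto
      show "\<Delta> p \<in> linear_span_rv unit_cube W"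
        using comb[OF BH[OF p(3)] BH[OF p(4)], of 1 "- 1"] unfolding \<Delta>_def[abs_def] by simp
      have "F (fst p) \<le> 1/2 + \<delta>" "F (snd p) \<le> 1/2 + \<delta>" using p by (auto simp: D_def)
      then show "expectation (\<lambda>\<omega>. (\<Delta> p \<omega>)\<^sup>2) \<le> \<sigma>2"
        using varBB[OF p(3,4)] cov[OF p(1,2)] zero_le_power2[of "F (fst p) - F (snd p)"]
        unfolding \<Delta>_def \<sigma>2_def by linarith
    qed (use \<sigma>2 in auto)
    then show ?thesis using that by blast
  qed

  \<comment> \<open>Upper bound for the overlap\<close>
  define \<kappa> where "\<kappa> = min (1 / (2 * (1/4 - \<delta>\<^sup>2/2))) (4 / (1 + \<sigma>2))"
  \<comment> \<open>Each rate beats 2, the rate for the variance 1/4 at \<open>x0\<close>. The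
    numerator 4 in the second one comes from the doubled level \<open>2 * a\<close>.\<close>
  have \<kappa>: "2 < \<kappa>" unfolding \<kappa>_def using d2 \<sigma>2 by (auto simp: field_simps)
  \<comment> \<open>Absolute values, since the signs of \<open>C1\<close> and \<open>C2\<close> are
    unknown.\<close>
  define C where "C = \<bar>C1\<bar> + \<bar>C2\<bar>"
  have upper: "Q u \<le> C * exp (- \<kappa> * (u - \<bar>w\<bar>)\<^sup>2)" if u: "u - \<bar>w\<bar> \<ge> max u1 (u2 / 2)" for u
  proof -
    define a where "a = u - \<bar>w\<bar>"
    let ?A1 = "{\<omega> \<in> space M. \<exists>x\<in>T - D. a < \<bar>B x \<omega>\<bar>}" and ?A2 = "{\<omega> \<in> space M. \<exists>p\<in>(T \<inter> D) \<times> (T \<inter> D). 2 * a < \<bar>\<Delta> p \<omega>\<bar>}"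
    have m1: "?A1 \<in> events" by (rule exceedance_sets) (use T mB in auto)
    have m2: "?A2 \<in> events"
    proof (rule exceedance_sets)
      fix p assume "p \<in> (T \<inter> D) \<times> (T \<inter> D)"
      then have [measurable]: "B (fst p) \<in> borel_measurable M" "B (snd p) \<in> borel_measurable M" using mB by auto
      show "\<Delta> p \<in> borel_measurable M" unfolding \<Delta>_def[abs_def] by measurable
    qed (use T in auto)
    have "P w u \<inter> N w u \<subseteq> ?A1 \<union> ?A2"
    proof
      fix \<omega> assume "\<omega> \<in> P w u \<inter> N w u"
      then obtain x y where \<omega>: "\<omega> \<in> space M" and xy: "x \<in> T" "y \<in> T"
        and gt: "u < B x \<omega> + F x * w" "u < - (B y \<omega> + F y * w)" by (auto simp: P_def N_def)
      have Fw: "\<bar>F z * w\<bar> \<le> \<bar>w\<bar>" if "z \<in> T" for z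
        using F01(1,2)[of z] that Tc mult_right_mono[of "F z" 1 "\<bar>w\<bar>"] by (auto simp: abs_mult)
      \<comment> \<open>As \<open>0 \<le> F \<le> 1\<close>, the drift costs at most
        \<open>\<bar>w\<bar>\<close>.\<close>
      have "a < B x \<omega>" "a < - B y \<omega>" using gt Fw[OF xy(1)] Fw[OF xy(2)] unfolding a_def by linarith+
      then have "a < \<bar>B x \<omega>\<bar>" "a < \<bar>B y \<omega>\<bar>" "2 * a < \<bar>\<Delta> (x, y) \<omega>\<bar>" unfolding \<Delta>_def by auto
      \<comment> \<open>If \<open>x\<close> or \<open>y\<close> lies outside of \<open>D\<close>,
        that point gives \<open>?A1\<close>; otherwise the opposite signs of \<open>B x\<close> and
        \<open>B y\<close> make the increment exceed \<open>2 * a\<close>.\<close>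
      then show "\<omega> \<in> ?A1 \<union> ?A2" using \<omega> xy by (cases "x \<in> D"; cases "y \<in> D") auto
    qed
    then have "Q u \<le> prob (?A1 \<union> ?A2)"
      unfolding Q_def using m1 m2 by (intro finite_measure_mono) auto
    also have "\<dots> \<le> prob ?A1 + prob ?A2" using m1 m2 by (rule measure_Un_le)
    also have "prob ?A1 \<le> C1 * exp (- a\<^sup>2 / (2 * (1/4 - \<delta>\<^sup>2/2)))"
      using u by (intro C1) (simp add: a_def)
    also have "\<dots> \<le> \<bar>C1\<bar> * exp (- \<kappa> * a\<^sup>2)"
    proof (rule mult_mono)
      have "\<kappa> * a\<^sup>2 \<le> 1 / (2 * (1/4 - \<delta>\<^sup>2/2)) * a\<^sup>2" by (intro mult_right_mono) (auto simp: \<kappa>_def)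
      then show "exp (- a\<^sup>2 / (2 * (1/4 - \<delta>\<^sup>2/2))) \<le> exp (- \<kappa> * a\<^sup>2)" by simp
    qed auto
    also have "prob ?A2 \<le> C2 * exp (- (2 * a)\<^sup>2 / (2 * ((1 + \<sigma>2) / 2)))"
      using u by (intro C2) (simp add: a_def)
    also have "\<dots> \<le> \<bar>C2\<bar> * exp (- \<kappa> * a\<^sup>2)"
    proof (rule mult_mono)
      have "\<kappa> * a\<^sup>2 \<le> 4 / (1 + \<sigma>2) * a\<^sup>2" by (intro mult_right_mono) (auto simp: \<kappa>_def)
      moreover have "2 * ((1 + \<sigma>2) / 2) = 1 + \<sigma>2" by (simp add: field_simps)
      ultimately show "exp (- (2 * a)\<^sup>2 / (2 * ((1 + \<sigma>2) / 2))) \<le> exp (- \<kappa> * a\<^sup>2)"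
        by (simp only:) (simp add: power_mult_distrib)
    qed auto
    finally show ?thesis by (simp add: C_def a_def algebra_simps)
  qed

  \<comment> \<open>Lower bound for the one-sided terms and the asymptotics\<close>
  define c where "c = 1 / sqrt (2 * pi * (1/4))"
  have c: "0 < c" by (simp add: c_def)
  have lower: "c * exp (- 2 * (u + 1)\<^sup>2) \<le> S u" if "0 \<le> u" for u
  proof -
    have "centered_gaussian_rv M (B x0) (1/4)"
      using rv(1)[OF BH[OF x0c]] varB[OF x0c] x0 by simp
    then have "exp (- (u + 1)\<^sup>2 / (2 * (1/4))) / sqrt (2 * pi * (1/4)) \<le> prob {\<omega> \<in> space M. u < B x0 \<omega>}"
      using that by (intro centered_gaussian_rv_tail_ge[OF prob_space_axioms]) auto
    also have "\<dots> \<le> prob (P \<bar>w\<bar> u)"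
    proof (rule finite_measure_mono[OF _ mP])
      have "0 \<le> F x0 * \<bar>w\<bar>" using x0 by simp
      then show "{\<omega> \<in> space M. u < B x0 \<omega>} \<subseteq> P \<bar>w\<bar> u"
        unfolding P_def using x0T by force
    qed
    also have "\<dots> \<le> S u"
      unfolding S_def by (cases "w \<ge> 0") auto
    finally show ?thesis by (simp add: c_def mult.commute)
  qed
  have S_pos: "0 < S u" if "0 \<le> u" for u
    using lower[OF that] c by (smt (verit) exp_gt_zero mult_pos_pos)
  have "((\<lambda>u. Q u / S u) \<longlongrightarrow> 0) at_top"
  proof (rule Lim_null_comparison)
    show "((\<lambda>u. C / c * (exp (- \<kappa> * (u - \<bar>w\<bar>)\<^sup>2) / exp (- 2 * (u + 1)\<^sup>2))) \<longlongrightarrow> 0) at_top"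
      by (intro tendsto_mult_right_zero tendsto_exp_quadratic_dominated \<kappa>)
    show "\<forall>\<^sub>F u in at_top. norm (Q u / S u) \<le> C / c * (exp (- \<kappa> * (u - \<bar>w\<bar>)\<^sup>2) / exp (- 2 * (u + 1)\<^sup>2))"
      using eventually_ge_at_top[of 0] eventually_ge_at_top[of "max u1 (u2 / 2) + \<bar>w\<bar>"]
    proof eventually_elim
      case (elim u)
      have "norm (Q u / S u) = Q u / S u" using S_pos[OF elim(1)] by (simp add: Q_def)
      also have "\<dots> \<le> (C * exp (- \<kappa> * (u - \<bar>w\<bar>)\<^sup>2)) / (c * exp (- 2 * (u + 1)\<^sup>2))"
        using elim c by (intro frac_le upper lower) (auto simp: C_def)
      finally show ?case by simp
    qed
  qed
  then have "((\<lambda>u. 1 - Q u / S u) \<longlongrightarrow> 1 - 0) at_top" by (intro tendsto_intros)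
  then have "((\<lambda>u. 1 - Q u / S u) \<longlongrightarrow> 1) at_top" by simp
  then have "((\<lambda>u. (S u - Q u) / S u) \<longlongrightarrow> 1) at_top"
  \<comment> \<open>Splitting the fraction needs \<open>S u\<close> nonzero, which is known from
    \<open>u = 0\<close> on.\<close>
  proof (rule Lim_transform_eventually)
    show "\<forall>\<^sub>F u in at_top. 1 - Q u / S u = (S u - Q u) / S u"
      using eventually_ge_at_top[of 0]
      by eventually_elim (use S_pos in \<open>auto simp: diff_divide_distrib less_imp_neq[symmetric]\<close>)
  qed
  then have "(\<lambda>u. S u - Q u) \<sim>[at_top] S" by (rule asymp_equivI')
  then show ?thesis
    unfolding cN cP incl_excl by (simp add: S_def[abs_def])
qed

end
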